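(* Let $K$ be an imaginary quadratic field, $f_\rho$ and $d$ positive integers, $N=(D_Kf_\rho)^2d^2$, and $\underline{\mathfrak c}=f_\rho\sqrt{D_K}\mathcal O_K$. For each positive divisor $d''$ of $d^2$ let $\iota_{d''}:F(\mathcal{E}ll(\mathcal O_K),f_\rho)\to S_2(\Gamma_1(N))$, $g\mapsto g|[\mathrm{diag}(d'',1)]_2$. Then the union of the images $\iota_{d''}(F(\mathcal{E}ll(\mathcal O_K),f_\rho))$ over all $d''\mid d^2$ contains: every Hecke theta function $\vartheta(\tau;\varphi)$ of a Hecke character $\varphi$ of $K$ of infinity type $[-1/2;1,0]$ whose conductor $\mathfrak c_f$ divides $\underline{\mathfrak c}$, and every function $\vartheta(\tau;\varphi)|[\mathrm{diag}(d'd'',1)]_2$ with such $\varphi$, $d''\mid d^2$, and $d'=\mathrm{Nm}_{K/\mathbb Q}(\mathfrak q_r)$ for some integral ideal $\mathfrak q_r$ dividing $\underline{\mathfrak c}\,\mathfrak c_f^{-1}$.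
   Context: Embed $K\subset\mathbb C$ with $\sqrt{D_K}$ in the upper half plane $\mathcal H$; $D_K<0$ the discriminant, $h$ the class number. Hecke character of infinity type $[-1/2;1,0]$ with conductor $\mathfrak c_f$: a homomorphism $\varphi$ from fractional ideals prime to $\mathfrak c_f$ to $\mathbb C^\times$ with $\varphi(\alpha\mathcal O_K)=\alpha\chi'_\varphi(\alpha)$ for $\alpha\in\mathcal O_K$ prime to $\mathfrak c_f$, $\chi'_\varphi$ a character of $(\mathcal O_K/\mathfrak c_f)^\times$, $\mathfrak c_f$ minimal. $\vartheta(\tau;\varphi)=\sum_I\varphi(I)e^{2\pi i\tau\mathrm{Nm}(I)}$ over nonzero integral ideals ($\varphi(I)=0$ if $I$ not prime to $\mathfrak c_f$). $(f|[\mathrm{diag}(r,1)]_2)(\tau)=rf(r\tau)$. Let $z_1,\dots,z_h\in\mathcal H$ represent the $\mathbb C$-isomorphism classes of elliptic curves with CM by $\mathcal O_K$; for $z=z_a$ let $(a_z,b_z,c_z)$ coprime, $a_z>0$, $a_zz^2+b_zz+c_z=0$. $\Lambda_a$: lattice with basis $e_2,e_1$ and Gram matrix $f_\rho\begin{pmatrix}2a_z&b_z\\ b_z&2c_z\end{pmatrix}$; $G_{\Lambda_a}=\Lambda_a^\vee/\Lambda_a$; $\Omega'_a$ the $\mathbb Q$-linear map with $\Omega'_a(e_2)=\sqrt{2a_zf_\rho}$, $\Omega'_a(e_1)=-\sqrt{2a_zf_\rho}z$; $f_a(\tau;\beta)=\sum_{y\in\Lambda_a^\vee,\,y+\Lambda_a=\beta}\Omega'_a(y)e^{\pi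 if_\rho|D_K|\tau(y,y)}$ for $\beta\in G_{\Lambda_a}$. $F(\mathcal{E}ll(\mathcal O_K),f_\rho)$ is the $\mathbb C$-span of all $f_a(\tau;\beta)$; it is contained in $S_2(\Gamma_1((D_Kf_\rho)^2))$. *)

theory Defs
  imports "HOL-Analysis.Analysis" "HOL-Computational_Algebra.Polynomial"
          "HOL-Computational_Algebra.Squarefree"
begin

text \<open>K is parametrised by its (negative) fundamental discriminant D = D_K.
  sqrt(D) is embedded in the upper half plane.\<close>

definition fundamental_disc :: "int \<Rightarrow> bool" where
  "fundamental_disc D \<longleftrightarrow> D \<noteq> 1 \<and>
     ((D mod 4 = 1 \<and> squarefree D) \<or>
      (\<exists>m. D = 4 * m \<and> (m mod 4 = 2 \<or> m mod 4 = 3) \<and> squarefree m))"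

definition sqrtD :: "int \<Rightarrow> complex" where
  "sqrtD D = \<i> * complex_of_real (sqrt (of_int (- D)))"

definition Kfield :: "int \<Rightarrow> complex set" where
  "Kfield D = {of_real (of_rat p) + of_real (of_rat q) * sqrtD D | p q. True}"

definition alg_int :: "complex \<Rightarrow> bool" where
  "alg_int \<alpha> \<longleftrightarrow> (\<exists>p :: int poly. lead_coeff p = 1 \<and> poly (map_poly of_int p) \<alpha> = 0)"

definition OK :: "int \<Rightarrow> complex set" where
  "OK D = {\<alpha> \<in> Kfield D. alg_int \<alpha>}"

definition int_ideal :: "int \<Rightarrow> complex set \<Rightarrow> bool" where
  "int_ideal D I \<longleftrightarrow> I \<subseteq> OK D \<and> I \<noteq> {0} \<and> 0 \<in> I \<and>
     (\<forall>x\<in>I. \<forall>y\<in>I. x + y \<in> I) \<and> (\<forall>r\<in>OK D. \<forall>x\<in>I. r * x \<in> I)"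

definition principal :: "int \<Rightarrow> complex \<Rightarrow> complex set" where
  "principal D \<alpha> = (\<lambda>x. \<alpha> * x) ` OK D"

definition ideal_mult :: "complex set \<Rightarrow> complex set \<Rightarrow> complex set" where
  "ideal_mult I J = {x. \<exists>n a b. (\<forall>i<n. a i \<in> I \<and> b i \<in> J) \<and> x = (\<Sum>i<(n::nat). a i * b i)}"

definition ideal_dvd :: "int \<Rightarrow> complex set \<Rightarrow> complex set \<Rightarrow> bool" where
  "ideal_dvd D I J \<longleftrightarrow> (\<exists>M. int_ideal D M \<and> J = ideal_mult I M)"

definition ideal_norm :: "int \<Rightarrow> complex set \<Rightarrow> nat" where
  "ideal_norm D I = card (OK D // {(x, y). x \<in> OK D \<and> y \<in> OK D \<and> x - y \<in> I})"

definition ideal_coprime :: "complex set \<Rightarrow> complex set \<Rightarrow> bool" where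
  "ideal_coprime I J \<longleftrightarrow> (\<exists>x\<in>I. \<exists>y\<in>J. x + y = 1)"

text \<open>A character of (O_K/c)^x, viewed as a function on elements of O_K prime to c.\<close>
definition char_mod :: "int \<Rightarrow> complex set \<Rightarrow> (complex \<Rightarrow> complex) \<Rightarrow> bool" where
  "char_mod D c chi \<longleftrightarrow>
     chi 1 = 1 \<and>
     (\<forall>\<alpha>\<in>OK D. \<forall>\<beta>\<in>OK D. ideal_coprime (principal D \<alpha>) c \<longrightarrow> ideal_coprime (principal D \<beta>) c \<longrightarrow>
        (\<alpha> - \<beta> \<in> c \<longrightarrow> chi \<alpha> = chi \<beta>) \<and> chi (\<alpha> * \<beta>) = chi \<alpha> * chi \<beta>)"

text \<open>phi admits the modulus c' (as defining modulus of its finite part), phi being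
  defined on ideals prime to c.\<close>
definition has_modulus :: "int \<Rightarrow> complex set \<Rightarrow> complex set \<Rightarrow> (complex set \<Rightarrow> complex) \<Rightarrow> bool" where
  "has_modulus D c c' \<phi> \<longleftrightarrow> (\<exists>chi. char_mod D c' chi \<and>
     (\<forall>\<alpha>\<in>OK D. ideal_coprime (principal D \<alpha>) c \<longrightarrow> \<phi> (principal D \<alpha>) = \<alpha> * chi \<alpha>))"

text \<open>phi is a Hecke character of infinity type [-1/2;1,0] with conductor c_f:
  a homomorphism on (integral, hence fractional) ideals prime to c_f with values in C^x,
  extended by 0 on integral ideals not prime to c_f, with c_f minimal.\<close>
definition hecke_char :: "int \<Rightarrow> complex set \<Rightarrow> (complex set \<Rightarrow> complex) \<Rightarrow> bool" where
  "hecke_char D cf \<phi> \<longleftrightarrow> int_ideal D cf \<and>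
     (\<forall>I. int_ideal D I \<longrightarrow> ideal_coprime I cf \<longrightarrow> \<phi> I \<noteq> 0) \<and>
     (\<forall>I J. int_ideal D I \<longrightarrow> int_ideal D J \<longrightarrow> ideal_coprime I cf \<longrightarrow> ideal_coprime J cf \<longrightarrow>
          \<phi> (ideal_mult I J) = \<phi> I * \<phi> J) \<and>
     (\<forall>I. int_ideal D I \<longrightarrow> \<not> ideal_coprime I cf \<longrightarrow> \<phi> I = 0) \<and>
     has_modulus D cf cf \<phi> \<and>
     (\<forall>c'. int_ideal D c' \<longrightarrow> ideal_dvd D c' cf \<longrightarrow> c' \<noteq> cf \<longrightarrow> \<not> has_modulus D cf c' \<phi>)"

definition theta :: "int \<Rightarrow> (complex set \<Rightarrow> complex) \<Rightarrow> complex \<Rightarrow> complex" where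
  "theta D \<phi> \<tau> = (\<Sum>\<^sub>\<infinity>I\<in>{I. int_ideal D I}.
      \<phi> I * exp (2 * of_real pi * \<i> * \<tau> * of_nat (ideal_norm D I)))"

definition slash :: "nat \<Rightarrow> (complex \<Rightarrow> complex) \<Rightarrow> complex \<Rightarrow> complex" where
  "slash r g \<tau> = of_nat r * g (of_nat r * \<tau>)"

definition uhp :: "complex set" where "uhp = {z. Im z > 0}"

definition lattice :: "complex \<Rightarrow> complex set" where
  "lattice z = {of_int m + of_int n * z | m n. True}"

definition has_CM :: "int \<Rightarrow> complex \<Rightarrow> bool" where
  "has_CM D z \<longleftrightarrow> {\<alpha>. (\<lambda>x. \<alpha> * x) ` lattice z \<subseteq> lattice z} = OK D"

definition lattice_iso :: "complex \<Rightarrow> complex \<Rightarrow> bool" where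
  "lattice_iso z w \<longleftrightarrow> (\<exists>c. c \<noteq> 0 \<and> lattice w = (\<lambda>x. c * x) ` lattice z)"

definition cm_reps :: "int \<Rightarrow> complex set \<Rightarrow> bool" where
  "cm_reps D reps \<longleftrightarrow> finite reps \<and> reps \<subseteq> uhp \<and> (\<forall>z\<in>reps. has_CM D z) \<and>
     (\<forall>w\<in>uhp. has_CM D w \<longrightarrow> (\<exists>z\<in>reps. lattice_iso z w)) \<and>
     (\<forall>z\<in>reps. \<forall>z'\<in>reps. lattice_iso z z' \<longrightarrow> z = z')"

definition abc_of :: "complex \<Rightarrow> int \<Rightarrow> int \<Rightarrow> int \<Rightarrow> bool" where
  "abc_of z a b c \<longleftrightarrow> gcd a (gcd b c) = 1 \<and> a > 0 \<and>
     of_int a * z\<^sup>2 + of_int b * z + of_int c = 0"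

text \<open>An element y = u e_2 + v e_1 of Lambda_a (x) Q lies in the dual lattice.\<close>
definition in_dual :: "nat \<Rightarrow> int \<Rightarrow> int \<Rightarrow> int \<Rightarrow> rat \<Rightarrow> rat \<Rightarrow> bool" where
  "in_dual f a b c u v \<longleftrightarrow>
     of_nat f * (2 * of_int a * u + of_int b * v) \<in> \<int> \<and>
     of_nat f * (of_int b * u + 2 * of_int c * v) \<in> \<int>"

definition qform :: "nat \<Rightarrow> int \<Rightarrow> int \<Rightarrow> int \<Rightarrow> real \<Rightarrow> real \<Rightarrow> real" where
  "qform f a b c u v = real f * (2 * of_int a * u\<^sup>2 + 2 * of_int b * u * v + 2 * of_int c * v\<^sup>2)"

definition Omega' :: "nat \<Rightarrow> complex \<Rightarrow> int \<Rightarrow> real \<Rightarrow> real \<Rightarrow> complex" where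
  "Omega' f z a u v = of_real (sqrt (2 * of_int a * real f)) * (of_real u - of_real v * z)"

text \<open>f_a(tau; beta) where beta is the class of (u,v) in Lambda^dual / Lambda.\<close>
definition fa :: "int \<Rightarrow> nat \<Rightarrow> complex \<Rightarrow> int \<Rightarrow> int \<Rightarrow> int \<Rightarrow> rat \<Rightarrow> rat \<Rightarrow> complex \<Rightarrow> complex" where
  "fa D f z a b c u v \<tau> = (\<Sum>\<^sub>\<infinity>(m,n)\<in>(UNIV :: (int \<times> int) set).
     Omega' f z a (of_rat u + of_int m) (of_rat v + of_int n) *
     exp (of_real pi * \<i> * of_nat f * of_int \<bar>D\<bar> * \<tau> *
          of_real (qform f a b c (of_rat u + of_int m) (of_rat v + of_int n))))"

definition genF :: "int \<Rightarrow> nat \<Rightarrow> complex set \<Rightarrow> (complex \<Rightarrow> complex) set" where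
  "genF D f reps = {fa D f z a b c u v | z a b c u v.
      z \<in> reps \<and> abc_of z a b c \<and> in_dual f a b c u v}"

definition inF :: "int \<Rightarrow> nat \<Rightarrow> complex set \<Rightarrow> (complex \<Rightarrow> complex) \<Rightarrow> bool" where
  "inF D f reps g \<longleftrightarrow> (\<exists>S k. finite S \<and> S \<subseteq> genF D f reps \<and>
      (\<forall>\<tau>\<in>uhp. g \<tau> = (\<Sum>h\<in>S. k h * h \<tau>)))"

definition in_union_images :: "int \<Rightarrow> nat \<Rightarrow> nat \<Rightarrow> complex set \<Rightarrow> (complex \<Rightarrow> complex) \<Rightarrow> bool" where
  "in_union_images D f d reps g \<longleftrightarrow> (\<exists>d''. 0 < d'' \<and> d'' dvd d\<^sup>2 \<and>
      (\<exists>h. inF D f reps h \<and> (\<forall>\<tau>\<in>uhp. g \<tau> = slash d'' h \<tau>)))"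

definition cbar :: "int \<Rightarrow> nat \<Rightarrow> complex set" where
  "cbar D f = principal D (of_nat f * sqrtD D)"

end

theory Submission
  imports Defs
begin

text \<open>
  Since \<open>\<surd>D = 2 a z + b\<close>, the dual of \<open>\<Lambda>\<close> is carried by \<open>\<Omega>'\<close>, up to a scalar, onto the lattice
  \<open>L = \<int> + \<int>z\<close>, and \<open>\<Lambda>\<close> itself onto \<open>f \<surd>D L\<close>. So the span \<open>F\<close> consists of the series
  \<open>\<Sum>x\<in>L. x \<psi>(x) exp(2 \<pi> i \<tau> Nm(x) / Nm(L))\<close> with \<open>\<psi>\<close> periodic modulo \<open>f \<surd>D L\<close>. On the other
  side, the integral ideals \<open>I\<close> for which \<open>I q L\<close> is principal are the \<open>x (q L)\<^sup>-\<^sup>1\<close> with \<open>x \<in> q L\<close>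
  nonzero, \<open>x\<close> being determined up to units. For these \<open>\<phi>(I)\<close> is \<open>x\<close> times a function of \<open>x\<close> modulo
  \<open>q cf L\<close>, and that function, extended by zero to \<open>L\<close>, is periodic modulo \<open>f \<surd>D L\<close> because \<open>q cf\<close>
  divides \<open>f \<surd>D\<close>. Summing over the ideal classes gives \<open>Nm(q) \<theta>(Nm(q) \<tau>; \<phi>) \<in> F\<close>; the case
  \<open>q = OK\<close> is the first claim.
\<close>

section \<open>The ring of integers\<close>

text \<open>The definitions know ideals only as sets and the norm only as a count of residue
  classes. Inverses, cancellation and multiplicativity of the norm are all drawn from binary
  quadratic forms: an integral ideal is an integer times a lattice \<open>\<int> + \<int> w\<close>
  with multiplier ring \<open>OK D\<close>, the primitive form of \<open>w\<close> has discriminant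
  \<open>D\<close>, and so the ideal times its conjugate is generated by its norm. Conjugation then
  serves as inversion. The obstacle on the Hecke side is that \<open>\<phi>\<close> is explicit only
  on principal ideals prime to the conductor, whereas the ideals of a class need not be principal.
  An auxiliary ideal in the inverse class, prime to the conductor, makes them so; it exists because
  a primitive form takes values prime to any given nonzero integer. On the analytic side, comparison
  with a double geometric series gives the absolute convergence by which a lattice sum splits into
  cosets. Regrouped over ideals, the sum counts each ideal once per unit, so the number of units is
  divided out.\<close>

lemma int_linear_relation_trivial:
  fixes z :: complex
  assumes "Im z \<noteq> 0" "of_int m + of_int n * z = 0"
  shows "m = 0 \<and> n = 0"
proof -
  have "Im (of_int m + of_int n * z) = 0" using assms by simp
  hence "n = 0" using assms(1) by simp
  thus ?thesis using assms(2) by simp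
qed

lemma map_poly_of_int_add:
  "map_poly (of_int :: int \<Rightarrow> complex) (p + q) = map_poly of_int p + map_poly of_int q"
  by (intro poly_eqI) (simp add: coeff_map_poly)

lemma map_poly_of_int_mult:
  "map_poly (of_int :: int \<Rightarrow> complex) (p * q) = map_poly of_int p * map_poly of_int q"
  by (intro poly_eqI) (simp add: coeff_map_poly coeff_mult)

text \<open>Gauss's lemma. Pseudo-division of a monic equation of \<open>z\<close> by the quadratic
  leaves a remainder of degree at most one, which vanishes at the nonreal \<open>z\<close> and hence
  identically. Comparing contents in \<open>a^k p = q s\<close> shows that \<open>q\<close> divides
  \<open>p\<close> over the integers, so its leading coefficient divides 1.\<close>

lemma primitive_quadratic_lead_coeff_unit:
  fixes z :: complex and a b c :: int
  assumes "alg_int z" "Im z \<noteq> 0" and g: "gcd a (gcd b c) = 1" and "a > 0"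
    and root: "of_int a * z\<^sup>2 + of_int b * z + of_int c = 0"
  shows "a = 1"
proof -
  obtain p :: "int poly" where p: "lead_coeff p = 1" "poly (map_poly of_int p) z = 0"
    using assms(1) by (auto simp: alg_int_def)
  let ?q = "[:c, b, a:]"
  have q0: "?q \<noteq> 0" "degree ?q = 2" "coeff ?q (degree ?q) = a" using \<open>a > 0\<close> by auto
  obtain s r where sr: "pseudo_divmod p ?q = (s, r)" by fastforce
  define k where "k = Suc (degree p) - degree ?q"
  note pd = pseudo_divmod[OF q0(1) sr]
  have qz: "poly (map_poly of_int ?q) z = 0"
    using root by (simp add: map_poly_pCons power2_eq_square algebra_simps)
  have eq: "[:a ^ k:] * p = ?q * s + r" using pd(1) q0 k_def by simp
  have rz: "poly (map_poly of_int r) z = 0"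
  proof -
    have "poly (map_poly of_int ([:a ^ k:] * p)) z = poly (map_poly of_int (?q * s + r)) z"
      using eq by simp
    thus ?thesis by (simp only: map_poly_of_int_add map_poly_of_int_mult poly_add poly_mult p qz mult_zero_left mult_zero_right add_0)
  qed
  have "degree r \<le> 1" using pd(2) q0(2) by auto
  hence r: "r = [:coeff r 0, coeff r 1:]"
    by (intro poly_eqI) (auto simp: coeff_pCons coeff_eq_0 split: nat.splits)
  have "of_int (coeff r 0) + of_int (coeff r 1) * z = 0"
    using rz by (subst (asm) r) (simp add: map_poly_pCons mult.commute)
  from int_linear_relation_trivial[OF assms(2) this] have "r = 0" using r by (metis pCons_0_0)
  with eq have e2: "smult (a ^ k) p = ?q * s" by simp
  have "content p dvd lead_coeff p" by (rule content_dvd_coeff)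
  hence "content p = 1" using p(1) is_unit_content_iff by metis
  moreover have "content ?q = 1"
  proof -
    have "content ?q dvd coeff ?q 0" "content ?q dvd coeff ?q 1" "content ?q dvd coeff ?q 2"
      by (rule content_dvd_coeff)+
    hence "content ?q dvd gcd a (gcd b c)"
      by (simp add: numeral_2_eq_2 del: content_dvd_coeff)
    thus ?thesis using g is_unit_content_iff by metis
  qed
  ultimately have "content s = a ^ k"
    using arg_cong[OF e2, of content] \<open>a > 0\<close>
    by (simp add: content_mult del: mult_pCons_left)
  hence "smult (a ^ k) p = smult (a ^ k) (?q * primitive_part s)"
    using e2 content_times_primitive_part[of s] by (metis mult_smult_right)
  hence "p = ?q * primitive_part s" using \<open>a > 0\<close>
    by (metis less_irrefl power_not_zero smult_cancel)
  hence "1 = a * lead_coeff (primitive_part s)" using p(1) q0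
    by (metis lead_coeff_mult)
  thus "a = 1" using \<open>a > 0\<close> by (metis abs_of_pos dvd_triv_left zdvd1_eq)
qed

lemma ex_primitive_quadratic:
  fixes z :: complex
  assumes "n \<noteq> 0" and root: "of_int n * z\<^sup>2 + of_int m * z + of_int k = 0"
  shows "\<exists>a b c. abc_of z a b c"
proof -
  \<comment> \<open>The sign of \<open>n\<close> is put into the common divisor so that the quotient
    \<open>a\<close> comes out positive.\<close>
  define g where "g = sgn n * gcd n (gcd m k)"
  have g0: "g \<noteq> 0" using assms by (simp add: g_def sgn_if)
  have "gcd n (gcd m k) dvd n" "gcd n (gcd m k) dvd m" "gcd n (gcd m k) dvd k"
    by (simp_all add: gcd_dvd1 dvd_trans[OF gcd_dvd2])
  hence "g dvd n" "g dvd m" "g dvd k" using assms(1) by (simp_all add: g_def sgn_if)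
  then obtain a b c where abc: "n = g * a" "m = g * b" "k = g * c" by (auto simp: dvd_def)
  have ga: "\<bar>g\<bar> = gcd n (gcd m k)" using assms by (simp add: g_def abs_mult sgn_if)
  have "\<bar>g\<bar> = \<bar>g\<bar> * gcd a (gcd b c)"
  proof -
    have "gcd (g * a) (gcd (g * b) (g * c)) = gcd (g * a) \<bar>g * gcd b c\<bar>"
      by (simp add: gcd_mult_left)
    also have "\<dots> = \<bar>g * gcd a (gcd b c)\<bar>" by (simp only: gcd_abs2_int) (simp add: gcd_mult_left)
    also have "\<dots> = \<bar>g\<bar> * gcd a (gcd b c)" by (simp add: abs_mult)
    finally show ?thesis by (rule trans[OF ga[unfolded abc]])
  qed
  hence 1: "gcd a (gcd b c) = 1" using g0 by simp
  have "a > 0"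
  proof -
    have "sgn g = sgn n" using assms(1) by (simp add: g_def sgn_mult)
    hence "sgn a = 1" using abc(1) g0
      by (metis mult_cancel_right1 mult.commute sgn_eq_0_iff sgn_mult)
    thus ?thesis by (simp add: sgn_1_pos)
  qed
  moreover have "of_int g * (of_int a * z\<^sup>2 + of_int b * z + of_int c) = 0"
    using root unfolding abc by (simp add: algebra_simps)
  hence "of_int a * z\<^sup>2 + of_int b * z + of_int c = 0" using g0 by simp
  ultimately show ?thesis using 1 unfolding abc_of_def by (intro exI conjI)
qed

lemma alg_int_quadratic:
  assumes "z\<^sup>2 + of_int b * z + of_int c = 0" shows "alg_int z"
  unfolding alg_int_def
  by (rule exI[of _ "[:c, b, 1:]"])
     (use assms in \<open>simp add: map_poly_pCons power2_eq_square algebra_simps\<close>)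

lemma squarefree_rat_square:
  fixes q :: rat
  assumes "squarefree m" "q\<^sup>2 * of_int m \<in> \<int>"
  shows "q \<in> \<int>"
proof -
  obtain x y where xy: "q = of_int x / of_int y" "y > 0" "coprime x y"
    by (metis quotient_of_coprime quotient_of_denom_pos quotient_of_div surj_pair)
  obtain k where "q\<^sup>2 * of_int m = of_int k" using assms(2) by (auto elim: Ints_cases)
  hence "of_int (x\<^sup>2 * m) = (of_int (k * y\<^sup>2) :: rat)" using xy(2)
    by (simp add: xy(1) field_simps power2_eq_square)
  hence "x\<^sup>2 * m = k * y\<^sup>2" by (simp only: of_int_eq_iff)
  hence "y\<^sup>2 dvd x\<^sup>2 * m" by simp
  moreover have "coprime (y\<^sup>2) (x\<^sup>2)" using xy(3) by (simp add: coprime_commute)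
  ultimately have "y\<^sup>2 dvd m" by (simp add: coprime_dvd_mult_right_iff)
  hence "y dvd 1" using assms(1) squarefreeD by blast
  hence "y = 1" using xy(2) by simp
  thus ?thesis using xy by simp
qed

section \<open>The maximal order of a negative fundamental discriminant\<close>

locale imag_quad =
  fixes D :: int
  assumes D_neg: "D < 0" and fund: "fundamental_disc D"
begin

text \<open>This choice serves both residues of \<open>D\<close> modulo 4, so that one basis
  \<open>1, \<omega>\<close> of the ring of integers covers both cases of a fundamental
  discriminant.\<close>

definition \<omega> :: complex where "\<omega> = (of_int D + sqrtD D) / 2"

lemma two_\<omega>: "2 * \<omega> = of_int D + sqrtD D"
  by (simp add: \<omega>_def)

lemma sqrtD_sq: "sqrtD D * sqrtD D = of_int D"
proof -
  have "sqrtD D * sqrtD D = - complex_of_real (sqrt (of_int (- D)) * sqrt (of_int (- D)))"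
    unfolding sqrtD_def by (simp add: algebra_simps flip: of_real_mult power2_eq_square)
  also have "sqrt (of_int (- D)) * sqrt (of_int (- D)) = of_int (- D)"
    using D_neg by (intro real_sqrt_mult_self[THEN trans]) simp
  finally show ?thesis by simp
qed

lemma Re_sqrtD [simp]: "Re (sqrtD D) = 0"
  by (simp add: sqrtD_def)

lemma Im_sqrtD_pos: "Im (sqrtD D) > 0"
  using D_neg by (simp add: sqrtD_def)

lemma sqrtD_nz [simp]: "sqrtD D \<noteq> 0"
  using Im_sqrtD_pos by auto

lemma cnj_sqrtD [simp]: "cnj (sqrtD D) = - sqrtD D"
  by (simp add: sqrtD_def)

lemma Im_\<omega>_pos: "Im \<omega> > 0"
  using Im_sqrtD_pos by (simp add: \<omega>_def)

lemma D_mod4: "4 dvd D * (D - 1)"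
proof -
  have "D mod 4 = 1 \<or> D mod 4 = 0" using fund by (auto simp: fundamental_disc_def)
  thus ?thesis by (metis dvd_mult dvd_mult2 mod_0_imp_dvd mod_eq_dvd_iff mod_mod_trivial)
qed

lemma \<omega>_sq: "\<omega> * \<omega> = of_int D * \<omega> - of_int (D * (D - 1) div 4)"
proof -
  have "4 * (D * (D - 1) div 4) = D * (D - 1)" using D_mod4 by simp
  hence "4 * (of_int (D * (D - 1) div 4) :: complex) = of_int D * (of_int D - 1)"
    by (metis of_int_mult of_int_numeral of_int_diff of_int_1)
  moreover have "4 * (\<omega> * \<omega>) = of_int D * of_int D + 2 * of_int D * sqrtD D + of_int D"
  proof -
    have "4 * (\<omega> * \<omega>) = (2 * \<omega>) * (2 * \<omega>)" by simp
    thus ?thesis unfolding two_\<omega> using sqrtD_sq by (simp add: algebra_simps)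
  qed
  moreover have "4 * (of_int D * \<omega>) = 2 * of_int D * (of_int D + sqrtD D)"
    unfolding two_\<omega>[symmetric] by simp
  ultimately have "4 * (\<omega> * \<omega>) = 4 * (of_int D * \<omega> - of_int (D * (D - 1) div 4))"
    by (simp add: algebra_simps)
  thus ?thesis by (simp only: mult_cancel_left) simp
qed

text \<open>For \<open>p + q sqrtD\<close> the hypotheses say that trace and norm are integers; the
  conclusions are the integrality of its coordinates \<open>p - q D\<close> and \<open>2 q\<close>
  with respect to \<open>1, \<omega>\<close>.\<close>

lemma half_integral_coordinates:
  fixes p q :: rat
  assumes "2 * p \<in> \<int>" "p\<^sup>2 - q\<^sup>2 * of_int D \<in> \<int>"
  shows "2 * q \<in> \<int> \<and> p - q * of_int D \<in> \<int>"
proof -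
  obtain r where r: "2 * p = of_int r" using assms(1) by (auto elim: Ints_cases)
  obtain k where k: "p\<^sup>2 - q\<^sup>2 * of_int D = of_int k" using assms(2) by (auto elim: Ints_cases)
  have rk: "(2 * q)\<^sup>2 * of_int D = of_int (r\<^sup>2 - 4 * k)"
    using r k by (simp add: power2_eq_square algebra_simps flip: r k)
  consider "D mod 4 = 1" "squarefree D" |
    m where "D = 4 * m" "m mod 4 = 2 \<or> m mod 4 = 3" "squarefree m"
    using fund by (auto simp: fundamental_disc_def)
  thus ?thesis
  proof cases
    case 1
    have "2 * q \<in> \<int>" using squarefree_rat_square[OF 1(2), of "2 * q"] rk by simp
    then obtain s where s: "2 * q = of_int s" by (auto elim: Ints_cases)
    have "of_int (s\<^sup>2 * D) = (of_int (r\<^sup>2 - 4 * k) :: rat)" using rk s by simp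
    hence "s\<^sup>2 * D = r\<^sup>2 - 4 * k" by (simp only: of_int_eq_iff)
    \<comment> \<open>As \<open>D\<close> is odd, \<open>s^2 D = r^2 - 4 k\<close> makes
      \<open>r\<close> and \<open>s D\<close> agree in parity.\<close>
    moreover have "odd D" using 1(1) by presburger
    ultimately have "even (r - s * D)"
      by (metis dvd_diff_right_iff even_diff even_mult_iff even_numeral even_power pos2 dvd_mult2 even_add)
    then obtain t where "r - s * D = 2 * t" by (auto simp: dvd_def)
    hence "(of_int r - of_int s * of_int D :: rat) = 2 * of_int t"
      by (metis of_int_diff of_int_mult of_int_numeral)
    hence "p - q * of_int D = of_int t" using r s by (simp add: field_simps flip: r s)
    thus ?thesis using \<open>2 * q \<in> \<int>\<close> by simp
  next
    case 2
    have "(4 * q)\<^sup>2 * of_int m = of_int (r\<^sup>2 - 4 * k)" using rk 2(1)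
      by (simp add: power2_eq_square)
    hence "4 * q \<in> \<int>" using squarefree_rat_square[OF 2(3), of "4 * q"] by simp
    then obtain s where s: "4 * q = of_int s" by (auto elim: Ints_cases)
    have "of_int (s\<^sup>2 * m) = (of_int (r\<^sup>2 - 4 * k) :: rat)"
      using \<open>(4 * q)\<^sup>2 * _ = _\<close> s by simp
    hence e: "s\<^sup>2 * m = r\<^sup>2 - 4 * k" by (simp only: of_int_eq_iff)
    \<comment> \<open>Squares are 0 or 1 modulo 4 and \<open>m\<close> is 2 or 3, so the congruence
      of \<open>s^2 m\<close> and \<open>r^2\<close> modulo 4 leaves only 0 on both sides.\<close>
    have "even s \<and> even r"
    proof -
      have sq: "x\<^sup>2 mod 4 = (if even x then 0 else 1)" for x :: int
      proof (cases "even x")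
        case True then show ?thesis by (auto elim!: evenE simp: power2_eq_square)
      next
        case False
        then obtain y where "x = 2 * y + 1" by (auto elim: oddE)
        hence "x\<^sup>2 = 4 * (y\<^sup>2 + y) + 1" by (simp add: power2_eq_square algebra_simps)
        hence "x\<^sup>2 mod 4 = 1" by presburger
        then show ?thesis using False by simp
      qed
      have "(s\<^sup>2 mod 4) * (m mod 4) mod 4 = r\<^sup>2 mod 4"
      proof -
        have "(s\<^sup>2 mod 4) * (m mod 4) mod 4 = (s\<^sup>2 * m) mod 4" by (rule mod_mult_eq)
        also have "\<dots> = r\<^sup>2 mod 4" unfolding e by presburger
        finally show ?thesis .
      qed
      thus ?thesis using 2(2) by (auto simp: sq split: if_splits)
    qed
    then obtain s' r' where "s = 2 * s'" "r = 2 * r'" by (auto elim!: evenE)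
    hence "2 * q = of_int s'" "p = of_int r'" using s r by auto
    moreover have "q * of_int D = of_int (2 * m * s')"
      using 2(1) arg_cong[OF \<open>2 * q = of_int s'\<close>, of "\<lambda>x. 2 * of_int m * x"] by simp
    ultimately show ?thesis by (metis Ints_diff Ints_of_int)
  qed
qed

lemma Kfield_root:
  "(of_real (of_rat p) + of_real (of_rat q) * sqrtD D)\<^sup>2
     - of_real (of_rat (2 * p)) * (of_real (of_rat p) + of_real (of_rat q) * sqrtD D)
     + of_real (of_rat (p\<^sup>2 - q\<^sup>2 * of_int D)) = 0"
proof -
  have "(of_real (of_rat q) * sqrtD D)\<^sup>2 = of_real (of_rat (q\<^sup>2 * of_int D))"
    using sqrtD_sq by (simp add: power2_eq_square of_rat_mult algebra_simps)
  thus ?thesis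
    by (simp add: of_rat_mult of_rat_diff power2_eq_square of_rat_power algebra_simps)
qed

text \<open>A nonreal algebraic integer of \<open>K\<close> satisfies its rational trace-norm
  equation and, by Gauss's lemma, a monic integral quadratic equation. Their difference is linear in
  \<open>x\<close>, hence trivial, so trace and norm are integers. In the remaining rational case an
  algebraic integer is an ordinary integer.\<close>

lemma OK_eq: "OK D = lattice \<omega>"
proof (intro equalityI subsetI)
  fix x assume "x \<in> OK D"
  then obtain p q where x: "x = of_real (of_rat p) + of_real (of_rat q) * sqrtD D"
    and ai: "alg_int x" by (auto simp: OK_def Kfield_def)
  have "2 * p \<in> \<int> \<and> p\<^sup>2 - q\<^sup>2 * of_int D \<in> \<int>"
  proof (cases "q = 0")
    case True
    have "algebraic_int x" using ai by (auto simp: alg_int_def algebraic_int_altdef_ipoly)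
    moreover have "x \<in> \<rat>" using x True by simp
    ultimately have "x \<in> \<int>" by (rule rational_algebraic_int_is_int)
    then obtain k where "x = of_int k" by (auto elim: Ints_cases)
    hence "complex_of_real (of_rat p) = of_real (of_rat (of_int k))" using x True by simp
    hence "p = of_int k" by (simp only: of_real_eq_iff of_rat_eq_iff)
    thus ?thesis using True by simp
  next
    case False
    have Imx: "Im x \<noteq> 0" using x False Im_sqrtD_pos by simp
    define T where "T = 2 * p"
    define Nn where "Nn = p\<^sup>2 - q\<^sup>2 * of_int D"
    have root: "x\<^sup>2 - of_real (of_rat T) * x + of_real (of_rat Nn) = 0"
      unfolding T_def Nn_def x by (rule Kfield_root)
    obtain t1 t2 where T: "T = of_int t1 / of_int t2" "t2 > 0"
      by (metis quotient_of_denom_pos quotient_of_div surj_pair)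
    obtain n1 n2 where N: "Nn = of_int n1 / of_int n2" "n2 > 0"
      by (metis quotient_of_denom_pos quotient_of_div surj_pair)
    have "of_int (t2 * n2) * x\<^sup>2 + of_int (- t1 * n2) * x + of_int (n1 * t2) =
        of_int (t2 * n2) * (x\<^sup>2 - of_real (of_rat T) * x + of_real (of_rat Nn))"
    proof -
      have "of_int t2 * complex_of_real (of_rat T) = of_int t1"
        "of_int n2 * complex_of_real (of_rat Nn) = of_int n1"
        using T N by (simp_all add: of_rat_divide)
      thus ?thesis
        by (simp only: of_int_mult of_int_minus flip: \<open>_ = of_int t1\<close> \<open>_ = of_int n1\<close>)
           (simp add: algebra_simps)
    qed
    also have "\<dots> = 0" using root by simp
    finally obtain a b c where abc: "abc_of x a b c"
      using ex_primitive_quadratic[of "t2 * n2" x "- t1 * n2" "n1 * t2"] T N by auto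
    hence "a = 1" using primitive_quadratic_lead_coeff_unit[OF ai Imx, of a b c]
      by (simp add: abc_of_def)
    hence r2: "x\<^sup>2 + of_int b * x + of_int c = 0" using abc by (simp add: abc_of_def)
    have lin: "of_real (of_int b + of_rat T) * x + of_real (of_int c - of_rat Nn) = 0"
      using arg_cong2[OF r2 root, of "(-)"] by (simp add: algebra_simps)
    have "Im (of_real (of_int b + of_rat T) * x + of_real (of_int c - of_rat Nn)) = 0"
      by (subst lin) simp
    hence b: "of_int b + of_rat T = (0::real)" using Imx
      by (simp del: of_real_add of_real_diff)
    have c: "of_int c - of_rat Nn = (0::real)" using lin[unfolded b]
      by (simp only: of_real_0 mult_zero_left add_0 of_real_eq_0_iff)
    have "of_rat T = (of_rat (of_int (- b)) :: real)" "of_rat Nn = (of_rat (of_int c) :: real)"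
      unfolding of_rat_of_int_eq using b c by linarith+
    hence "T = of_int (- b)" "Nn = of_int c" by (simp_all only: of_rat_eq_iff)
    thus ?thesis unfolding T_def Nn_def by auto
  qed
  hence "2 * q \<in> \<int>" "p - q * of_int D \<in> \<int>" using half_integral_coordinates by blast+
  then obtain s t where st: "2 * q = of_int s" "p - q * of_int D = of_int t" by (auto elim!: Ints_cases)
  have q: "q = of_int s / 2" and p: "p = of_int t + of_int s / 2 * of_int D"
    using st by (auto simp: algebra_simps)
  have "x = of_int t + of_int s * \<omega>"
    unfolding x p q by (simp add: of_rat_add of_rat_mult of_rat_divide \<omega>_def field_simps)
  thus "x \<in> lattice \<omega>" by (auto simp: lattice_def)
next
  fix x assume "x \<in> lattice \<omega>"
  then obtain m n where x: "x = of_int m + of_int n * \<omega>" by (auto simp: lattice_def)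
  have "x = of_real (of_rat (of_int m + of_int n * of_int D / 2)) + of_real (of_rat (of_int n / 2)) * sqrtD D"
    unfolding x by (simp add: of_rat_add of_rat_mult of_rat_divide \<omega>_def field_simps)
  hence "x \<in> Kfield D" by (auto simp: Kfield_def)
  moreover have "x\<^sup>2 + of_int (- (2 * m + n * D)) * x
      + of_int (m\<^sup>2 + m * n * D + n\<^sup>2 * (D * (D - 1) div 4)) = 0"
  proof -
    have "x\<^sup>2 = of_int m * of_int m + 2 * of_int m * of_int n * \<omega> + of_int n * of_int n * (\<omega> * \<omega>)"
      unfolding x by (simp add: power2_eq_square algebra_simps)
    also have "\<dots> = of_int m * of_int m + 2 * of_int m * of_int n * \<omega>
        + of_int n * of_int n * (of_int D * \<omega>) - of_int n * of_int n * of_int (D * (D - 1) div 4)"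
      unfolding \<omega>_sq by (simp only: right_diff_distrib add_diff_eq)
    also have "of_int n * of_int n * (of_int D * \<omega>) = of_int n * of_int D * (x - of_int m)"
      unfolding x by simp
    also have "2 * of_int m * of_int n * \<omega> = 2 * of_int m * (x - of_int m)"
      unfolding x by simp
    finally show ?thesis by (simp add: algebra_simps power2_eq_square)
  qed
  hence "alg_int x" by (rule alg_int_quadratic)
  ultimately show "x \<in> OK D" by (simp add: OK_def)
qed

lemma OK_iff: "x \<in> OK D \<longleftrightarrow> (\<exists>m n. x = of_int m + of_int n * \<omega>)"
  by (auto simp: OK_eq lattice_def)

lemma OK_of_int [simp]: "of_int k \<in> OK D"
  unfolding OK_iff by (rule exI[of _ k], rule exI[of _ 0]) simp

lemma OK_0 [simp]: "0 \<in> OK D" and OK_1 [simp]: "1 \<in> OK D"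
  using OK_of_int[of 0] OK_of_int[of 1] by simp_all

lemma OK_\<omega> [simp]: "\<omega> \<in> OK D"
  unfolding OK_iff by (rule exI[of _ 0], rule exI[of _ 1]) simp

lemma OK_add: "x \<in> OK D \<Longrightarrow> y \<in> OK D \<Longrightarrow> x + y \<in> OK D"
proof -
  assume "x \<in> OK D" "y \<in> OK D"
  then obtain m n m' n' where "x = of_int m + of_int n * \<omega>" "y = of_int m' + of_int n' * \<omega>"
    by (auto simp: OK_iff)
  hence "x + y = of_int (m + m') + of_int (n + n') * \<omega>" by (simp add: algebra_simps)
  thus ?thesis unfolding OK_iff by blast
qed

lemma OK_mult: "x \<in> OK D \<Longrightarrow> y \<in> OK D \<Longrightarrow> x * y \<in> OK D"
proof -
  assume "x \<in> OK D" "y \<in> OK D"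
  then obtain m n m' n' where *: "x = of_int m + of_int n * \<omega>" "y = of_int m' + of_int n' * \<omega>"
    by (auto simp: OK_iff)
  have "x * y = of_int m * of_int m' + (of_int m * of_int n' + of_int m' * of_int n) * \<omega>
      + of_int n * of_int n' * (\<omega> * \<omega>)"
    unfolding * by (simp add: algebra_simps)
  also have "\<dots> = of_int (m * m' - n * n' * (D * (D - 1) div 4))
      + of_int (m * n' + m' * n + n * n' * D) * \<omega>"
    unfolding \<omega>_sq by (simp add: algebra_simps)
  finally show ?thesis unfolding OK_iff by blast
qed

lemma OK_uminus: "x \<in> OK D \<Longrightarrow> - x \<in> OK D"
  using OK_mult[of "of_int (-1)" x] OK_of_int[of "-1"] by simp

lemma OK_diff: "x \<in> OK D \<Longrightarrow> y \<in> OK D \<Longrightarrow> x - y \<in> OK D"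
  using OK_add[OF _ OK_uminus] by (metis diff_conv_add_uminus)

lemma cnj_\<omega>: "cnj \<omega> = of_int D - \<omega>"
  by (simp add: \<omega>_def field_simps)

lemma OK_cnj: "x \<in> OK D \<Longrightarrow> cnj x \<in> OK D"
  by (auto simp: OK_iff[of x] cnj_\<omega> intro!: OK_add OK_mult OK_diff)

lemma cnj_OK [simp]: "cnj ` OK D = OK D"
proof (intro equalityI subsetI)
  fix x assume "x \<in> OK D"
  hence "cnj (cnj x) \<in> cnj ` OK D" by (intro imageI OK_cnj)
  thus "x \<in> cnj ` OK D" by simp
qed (auto intro: OK_cnj)

end

section \<open>Products of ideals\<close>

lemma ideal_mult_0: "0 \<in> ideal_mult I J"
  unfolding ideal_mult_def by (auto intro!: exI[of _ 0])

lemma ideal_mult_prod: "a \<in> I \<Longrightarrow> b \<in> J \<Longrightarrow> a * b \<in> ideal_mult I J"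
  unfolding ideal_mult_def
  by (intro CollectI exI[of _ "1::nat"] exI[of _ "\<lambda>_. a"] exI[of _ "\<lambda>_. b"]) auto

lemma ideal_mult_add:
  assumes "x \<in> ideal_mult I J" "y \<in> ideal_mult I J"
  shows "x + y \<in> ideal_mult I J"
proof -
  obtain n a b where x: "\<forall>i<n. a i \<in> I \<and> b i \<in> J" "x = (\<Sum>i<(n::nat). a i * b i)"
    using assms(1) by (auto simp: ideal_mult_def)
  obtain n' a' b' where y: "\<forall>i<n'. a' i \<in> I \<and> b' i \<in> J" "y = (\<Sum>i<(n'::nat). a' i * b' i)"
    using assms(2) by (auto simp: ideal_mult_def)
  define A where "A i = (if i < n then a i else a' (i - n))" for i
  define B where "B i = (if i < n then b i else b' (i - n))" for i
  have "(\<Sum>i<n + n'. A i * B i) = (\<Sum>i<n. A i * B i) + (\<Sum>i<n'. A (i + n) * B (i + n))"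
    using sum.shift_bounds_nat_ivl[of "\<lambda>i. A i * B i" 0 n n']
      sum.atLeastLessThan_concat[of 0 n "n + n'" "\<lambda>i. A i * B i"]
    by (simp add: lessThan_atLeast0 add.commute)
  also have "\<dots> = x + y" unfolding x y by (simp add: A_def B_def)
  finally show ?thesis unfolding ideal_mult_def
    using x y by (intro CollectI exI[of _ "n + n'"] exI[of _ A] exI[of _ B]) (auto simp: A_def B_def)
qed

text \<open>The product is the smallest additively closed set with 0 that contains all
  \<open>a * b\<close>; most inclusions between products below are checked on such generators
  only.\<close>

lemma ideal_mult_subset:
  assumes "\<And>a b. a \<in> I \<Longrightarrow> b \<in> J \<Longrightarrow> a * b \<in> S" "0 \<in> S" "\<And>x y. x \<in> S \<Longrightarrow> y \<in> S \<Longrightarrow> x + y \<in> S"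
  shows "ideal_mult I J \<subseteq> S"
proof
  fix x assume "x \<in> ideal_mult I J"
  then obtain n a b where "\<forall>i<n. a i \<in> I \<and> b i \<in> J" and x: "x = (\<Sum>i<(n::nat). a i * b i)"
    by (auto simp: ideal_mult_def)
  hence "(\<Sum>i<n. a i * b i) \<in> S"
    by (induction n arbitrary: x) (auto intro: assms)
  thus "x \<in> S" using x by simp
qed

lemma ideal_mult_commute: "ideal_mult I J = ideal_mult J I"
proof -
  have "ideal_mult I J \<subseteq> ideal_mult J I" for I J
    by (rule ideal_mult_subset)
       (metis ideal_mult_prod mult.commute, auto intro: ideal_mult_0 ideal_mult_add)
  thus ?thesis by blast
qed

lemma ideal_mult_assoc: "ideal_mult (ideal_mult I J) K = ideal_mult I (ideal_mult J K)"
proof -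
  have *: "ideal_mult (ideal_mult I J) K \<subseteq> ideal_mult I (ideal_mult J K)" for I J K
  proof (rule ideal_mult_subset)
    fix x k assume "x \<in> ideal_mult I J" "k \<in> K"
    have "ideal_mult I J \<subseteq> {x. x * k \<in> ideal_mult I (ideal_mult J K)}"
    proof (rule ideal_mult_subset)
      fix a b assume "a \<in> I" "b \<in> J"
      hence "a * (b * k) \<in> ideal_mult I (ideal_mult J K)"
        using \<open>k \<in> K\<close> by (intro ideal_mult_prod)
      thus "a * b \<in> {x. x * k \<in> ideal_mult I (ideal_mult J K)}" by (simp add: mult.assoc)
    qed (auto intro: ideal_mult_0 ideal_mult_add simp: distrib_right)
    thus "x * k \<in> ideal_mult I (ideal_mult J K)" using \<open>x \<in> _\<close> by blast
  qed (auto intro: ideal_mult_0 ideal_mult_add)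
  show ?thesis
  proof
    show "ideal_mult I (ideal_mult J K) \<subseteq> ideal_mult (ideal_mult I J) K"
    proof -
      have "ideal_mult I (ideal_mult J K) = ideal_mult (ideal_mult K J) I"
        by (metis ideal_mult_commute)
      also have "\<dots> \<subseteq> ideal_mult K (ideal_mult J I)" by (rule *)
      also have "\<dots> = ideal_mult (ideal_mult I J) K" by (metis ideal_mult_commute)
      finally show ?thesis .
    qed
  qed (rule *)
qed

abbreviation sc :: "complex \<Rightarrow> complex set \<Rightarrow> complex set" where
  "sc c I \<equiv> (\<lambda>x. c * x) ` I"

lemma sc_sc: "sc a (sc b I) = sc (a * b) I"
  by (auto simp: image_image mult.assoc)

lemma sc_inverse: "c \<noteq> 0 \<Longrightarrow> J = sc c I \<longleftrightarrow> I = sc (1 / c) J"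
proof -
  assume "c \<noteq> 0"
  hence "sc c (sc (1 / c) J) = J" "sc (1 / c) (sc c I) = I" by (simp_all only: sc_sc) simp_all
  thus ?thesis by auto
qed

lemma sc_cancel: "c \<noteq> 0 \<Longrightarrow> sc c I = sc c J \<Longrightarrow> I = J"
  using sc_inverse[of c "sc c I" I] sc_inverse[of c "sc c I" J] by simp

lemma ideal_mult_sc: "ideal_mult (sc c I) J = sc c (ideal_mult I J)"
proof
  show "ideal_mult (sc c I) J \<subseteq> sc c (ideal_mult I J)"
  proof (rule ideal_mult_subset)
    fix x y assume "x \<in> sc c (ideal_mult I J)" "y \<in> sc c (ideal_mult I J)"
    then obtain x' y' where "x = c * x'" "y = c * y'" "x' \<in> ideal_mult I J" "y' \<in> ideal_mult I J" by auto
    thus "x + y \<in> sc c (ideal_mult I J)"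
      by (intro image_eqI[of _ _ "x' + y'"]) (auto simp: distrib_left intro: ideal_mult_add)
  qed (use ideal_mult_0 in \<open>force simp: mult.assoc intro: ideal_mult_prod imageI\<close>)+
  have "ideal_mult I J \<subseteq> {x. c * x \<in> ideal_mult (sc c I) J}"
  proof (rule ideal_mult_subset)
    fix a b assume "a \<in> I" "b \<in> J"
    hence "(c * a) * b \<in> ideal_mult (sc c I) J" by (intro ideal_mult_prod) auto
    thus "a * b \<in> {x. c * x \<in> ideal_mult (sc c I) J}" by (simp add: mult.assoc)
  qed (auto intro: ideal_mult_0 ideal_mult_add simp: distrib_left)
  thus "sc c (ideal_mult I J) \<subseteq> ideal_mult (sc c I) J" by auto
qed

lemma ideal_mult_sc_right: "ideal_mult I (sc c J) = sc c (ideal_mult I J)"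
  by (metis ideal_mult_commute ideal_mult_sc)

lemma cnj_sc: "cnj ` sc c I = sc (cnj c) (cnj ` I)"
  by (auto simp: image_image)

lemma cnj_cnj_image [simp]: "cnj ` cnj ` I = I"
  by (auto simp: image_image)

lemma cnj_ideal_mult: "cnj ` ideal_mult I J = ideal_mult (cnj ` I) (cnj ` J)"
proof -
  have *: "ideal_mult (cnj ` I) (cnj ` J) \<subseteq> cnj ` ideal_mult I J" for I J
  proof (rule ideal_mult_subset)
    fix x y assume "x \<in> cnj ` ideal_mult I J" "y \<in> cnj ` ideal_mult I J"
    then obtain x' y' where "x = cnj x'" "y = cnj y'" "x' \<in> ideal_mult I J" "y' \<in> ideal_mult I J" by auto
    thus "x + y \<in> cnj ` ideal_mult I J"
      by (intro image_eqI[of _ _ "x' + y'"]) (auto intro: ideal_mult_add)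
  next
    show "0 \<in> cnj ` ideal_mult I J" by (intro image_eqI[of _ _ 0] ideal_mult_0) simp
  next
    fix a b assume "a \<in> cnj ` I" "b \<in> cnj ` J"
    then obtain a' b' where "a = cnj a'" "b = cnj b'" "a' \<in> I" "b' \<in> J" by auto
    thus "a * b \<in> cnj ` ideal_mult I J"
      by (intro image_eqI[of _ _ "a' * b'"]) (auto intro: ideal_mult_prod)
  qed
  have "cnj ` ideal_mult I J \<subseteq> cnj ` cnj ` ideal_mult (cnj ` I) (cnj ` J)"
    using *[of "cnj ` I" "cnj ` J"] by (intro image_mono) simp
  thus ?thesis using *[of I J] by auto
qed

section \<open>Modules over the ring of integers and integral ideals\<close>

context imag_quad
begin

text \<open>Submodules of the complex numbers rather than ideals, since CM lattices and scaled
  conjugates, which need not be integral, occur as factors of products too.\<close>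

definition omod :: "complex set \<Rightarrow> bool" where
  "omod M \<longleftrightarrow> 0 \<in> M \<and> (\<forall>x\<in>M. \<forall>y\<in>M. x + y \<in> M) \<and> (\<forall>r\<in>OK D. \<forall>x\<in>M. r * x \<in> M)"

lemma omodD:
  assumes "omod M"
  shows "0 \<in> M" "x \<in> M \<Longrightarrow> y \<in> M \<Longrightarrow> x + y \<in> M" "r \<in> OK D \<Longrightarrow> x \<in> M \<Longrightarrow> r * x \<in> M"
    "x \<in> M \<Longrightarrow> - x \<in> M" "x \<in> M \<Longrightarrow> y \<in> M \<Longrightarrow> x - y \<in> M"
proof -
  show 1: "x \<in> M \<Longrightarrow> - x \<in> M" for x
  proof -
    assume "x \<in> M"
    have "of_int (-1) * x \<in> M" using assms OK_of_int[of "-1"] \<open>x \<in> M\<close> unfolding omod_def by blast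
    thus ?thesis by simp
  qed
  show "x \<in> M \<Longrightarrow> y \<in> M \<Longrightarrow> x - y \<in> M"
  proof -
    assume "x \<in> M" "y \<in> M"
    hence "x + - y \<in> M" using assms 1[of y] unfolding omod_def by blast
    thus ?thesis by simp
  qed
qed (use assms in \<open>auto simp: omod_def\<close>)

lemma int_ideal_iff: "int_ideal D I \<longleftrightarrow> omod I \<and> I \<subseteq> OK D \<and> I \<noteq> {0}"
  by (auto simp: int_ideal_def omod_def)

lemma omod_OK: "omod (OK D)"
  by (auto simp: omod_def intro: OK_add OK_mult)

lemma omod_sc: assumes "omod M" shows "omod (sc c M)"
  unfolding omod_def
proof (intro conjI ballI)
  show "0 \<in> sc c M" using omodD(1)[OF assms] by force
next
  fix x y assume "x \<in> sc c M" "y \<in> sc c M"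
  then obtain x' y' where "x = c * x'" "y = c * y'" "x' \<in> M" "y' \<in> M" by auto
  thus "x + y \<in> sc c M"
    by (intro image_eqI[of _ _ "x' + y'"]) (auto simp: distrib_left intro: omodD(2)[OF assms])
next
  fix r x assume "r \<in> OK D" "x \<in> sc c M"
  then obtain x' where "x = c * x'" "x' \<in> M" by auto
  thus "r * x \<in> sc c M" using \<open>r \<in> OK D\<close>
    by (intro image_eqI[of _ _ "r * x'"]) (auto intro: omodD(3)[OF assms])
qed

lemma omod_cnj: assumes "omod M" shows "omod (cnj ` M)"
  unfolding omod_def
proof (intro conjI ballI)
  show "0 \<in> cnj ` M" using omodD(1)[OF assms] by force
next
  fix x y assume "x \<in> cnj ` M" "y \<in> cnj ` M"
  then obtain x' y' where "x = cnj x'" "y = cnj y'" "x' \<in> M" "y' \<in> M" by auto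
  thus "x + y \<in> cnj ` M"
    by (intro image_eqI[of _ _ "x' + y'"]) (auto intro: omodD(2)[OF assms])
next
  fix r x assume "r \<in> OK D" "x \<in> cnj ` M"
  then obtain x' where "x = cnj x'" "x' \<in> M" by auto
  thus "r * x \<in> cnj ` M" using OK_cnj[OF \<open>r \<in> OK D\<close>]
    by (intro image_eqI[of _ _ "cnj r * x'"]) (auto intro: omodD(3)[OF assms])
qed

lemma omod_ideal_mult: assumes "omod I" shows "omod (ideal_mult I J)"
  unfolding omod_def
proof (intro conjI ballI)
  fix r x assume "r \<in> OK D" "x \<in> ideal_mult I J"
  have "ideal_mult I J \<subseteq> {x. r * x \<in> ideal_mult I J}"
  proof (rule ideal_mult_subset)
    fix a b assume "a \<in> I" "b \<in> J"
    hence "(r * a) * b \<in> ideal_mult I J"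
      using \<open>r \<in> OK D\<close> by (intro ideal_mult_prod omodD(3)[OF assms])
    thus "a * b \<in> {x. r * x \<in> ideal_mult I J}" by (simp add: mult.assoc)
  qed (auto intro: ideal_mult_0 ideal_mult_add simp: distrib_left)
  thus "r * x \<in> ideal_mult I J" using \<open>x \<in> _\<close> by blast
qed (auto intro: ideal_mult_0 ideal_mult_add)

lemma ideal_mult_OK: assumes "omod M" shows "ideal_mult (OK D) M = M"
proof
  show "ideal_mult (OK D) M \<subseteq> M"
    by (rule ideal_mult_subset) (auto intro: omodD[OF assms])
  show "M \<subseteq> ideal_mult (OK D) M"
    using ideal_mult_prod[OF OK_1, of _ M] by auto
qed

lemma principal_mult: "omod M \<Longrightarrow> ideal_mult (principal D a) M = sc a M"
  unfolding principal_def by (simp only: ideal_mult_sc ideal_mult_OK)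

lemma omod_principal: "omod (principal D a)"
  unfolding principal_def by (rule omod_sc[OF omod_OK])

lemma principal_mult_principal:
  "ideal_mult (principal D a) (principal D b) = principal D (a * b)"
proof -
  have "ideal_mult (principal D a) (principal D b) = sc a (principal D b)"
    by (rule principal_mult[OF omod_principal])
  also have "\<dots> = principal D (a * b)" unfolding principal_def by (rule sc_sc)
  finally show ?thesis .
qed

lemma principal_1: "principal D 1 = OK D"
  by (simp add: principal_def)

lemma in_principal: "a \<in> principal D a"
  unfolding principal_def by (rule image_eqI[of _ _ 1]) auto

lemma cnj_principal: "cnj ` principal D a = principal D (cnj a)"
  unfolding principal_def cnj_sc by simp

lemma int_ideal_nz: assumes "int_ideal D I" obtains x where "x \<in> I" "x \<noteq> 0"
  using assms by (auto simp: int_ideal_def)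

lemma int_ideal_OK: "int_ideal D (OK D)"
proof -
  have "OK D \<noteq> {0}" using OK_1 by force
  thus ?thesis by (simp add: int_ideal_iff omod_OK)
qed

lemma int_ideal_principal: assumes "a \<in> OK D" "a \<noteq> 0" shows "int_ideal D (principal D a)"
proof -
  have "principal D a \<noteq> {0}" using assms(2) in_principal[of a] by blast
  moreover have "principal D a \<subseteq> OK D" using assms(1) by (auto simp: principal_def intro: OK_mult)
  ultimately show ?thesis by (simp add: int_ideal_iff omod_principal)
qed

lemma int_ideal_mult:
  assumes "int_ideal D I" "int_ideal D J" shows "int_ideal D (ideal_mult I J)"
proof -
  obtain x y where "x \<in> I" "x \<noteq> 0" "y \<in> J" "y \<noteq> 0" using assms by (metis int_ideal_nz)
  hence "x * y \<in> ideal_mult I J" "x * y \<noteq> 0" by (auto intro: ideal_mult_prod)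
  hence "ideal_mult I J \<noteq> {0}" by blast
  moreover have "ideal_mult I J \<subseteq> OK D"
    using assms by (intro ideal_mult_subset) (auto simp: int_ideal_iff intro: OK_add OK_mult)
  ultimately show ?thesis using assms by (auto simp: int_ideal_iff omod_ideal_mult)
qed

lemma int_ideal_cnj: assumes "int_ideal D I" shows "int_ideal D (cnj ` I)"
proof -
  obtain x where "x \<in> I" "x \<noteq> 0" using assms by (rule int_ideal_nz)
  hence "cnj x \<in> cnj ` I" "cnj x \<noteq> 0" by auto
  hence "cnj ` I \<noteq> {0}" by blast
  thus ?thesis using assms by (auto simp: int_ideal_iff omod_cnj intro: OK_cnj)
qed

lemma ideal_mult_subset_left:
  assumes "int_ideal D I" "J \<subseteq> OK D" shows "ideal_mult I J \<subseteq> I"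
proof (rule ideal_mult_subset)
  have I: "omod I" using assms by (simp add: int_ideal_iff)
  fix a b assume "a \<in> I" "b \<in> J"
  thus "a * b \<in> I" using omodD(3)[OF I, of b a] assms(2) by (auto simp: mult.commute)
qed (use assms in \<open>simp_all add: int_ideal_def\<close>)

text \<open>The number \<open>x * cnj x\<close> lies in the ring of integers and is real, so its
  \<open>\<omega>\<close>-coordinate vanishes.\<close>

lemma OK_norm:
  assumes "x \<in> OK D" "x \<noteq> 0"
  obtains n :: int where "n > 0" "x * cnj x = of_int n"
proof -
  obtain m n where x: "x = of_int m + of_int n * \<omega>" using assms by (auto simp: OK_iff)
  have "x * cnj x \<in> OK D" using assms by (intro OK_mult OK_cnj)
  then obtain k l where kl: "x * cnj x = of_int k + of_int l * \<omega>" by (auto simp: OK_iff)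
  have c: "x * cnj x = of_real ((cmod x)\<^sup>2)" by (simp only: complex_norm_square)
  hence "Im (x * cnj x) = 0" by simp
  hence "l = 0" using kl Im_\<omega>_pos by simp
  hence k: "x * cnj x = of_int k" using kl by simp
  hence "complex_of_real ((cmod x)\<^sup>2) = of_real (of_int k)" using c by simp
  hence "(cmod x)\<^sup>2 = of_int k" by (simp only: of_real_eq_iff)
  moreover have "(cmod x)\<^sup>2 > 0" using assms by simp
  ultimately have "k > 0" by simp
  thus ?thesis using k that by blast
qed

end

section \<open>Ideals as lattices with complex multiplication\<close>

lemma int_combination_1:
  fixes a b c :: int
  assumes "gcd a (gcd b c) = 1"
  obtains p q r where "p * a + q * b + r * c = 1"
proof -
  obtain u v where uv: "u * a + v * gcd b c = 1" using bezout_int[of a "gcd b c"] assms by metis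
  obtain s t where "s * b + t * c = gcd b c" using bezout_int[of b c] by metis
  hence "u * a + v * (s * b + t * c) = 1" using uv by simp
  hence "u * a + (v * s) * b + (v * t) * c = 1" by (simp add: algebra_simps)
  thus ?thesis by (rule that)
qed

lemma lattice_add: "x \<in> lattice z \<Longrightarrow> y \<in> lattice z \<Longrightarrow> x + y \<in> lattice z"
proof -
  assume "x \<in> lattice z" "y \<in> lattice z"
  then obtain m n m' n' where "x = of_int m + of_int n * z" "y = of_int m' + of_int n' * z"
    by (auto simp: lattice_def)
  hence "x + y = of_int (m + m') + of_int (n + n') * z" by (simp add: algebra_simps)
  thus ?thesis unfolding lattice_def by blast
qed

lemma latticeE: assumes "x \<in> lattice z" obtains m n where "x = of_int m + of_int n * z"
  using assms unfolding lattice_def by blast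

lemma lattice_of_int: "of_int m \<in> lattice z"
  unfolding lattice_def by (intro CollectI exI[of _ m] exI[of _ 0]) simp

lemma lattice_0: "0 \<in> lattice z" and lattice_1: "1 \<in> lattice z"
  using lattice_of_int[of 0 z] lattice_of_int[of 1 z] by simp_all

lemma lattice_self: "z \<in> lattice z"
  unfolding lattice_def by (intro CollectI exI[of _ 0] exI[of _ 1]) simp

lemma lattice_multiplierE:
  assumes "sc \<alpha> (lattice z) \<subseteq> lattice z"
  obtains m n m' n' where "\<alpha> = of_int m + of_int n * z" "\<alpha> * z = of_int m' + of_int n' * z"
proof -
  have "\<alpha> * 1 \<in> lattice z" "\<alpha> * z \<in> lattice z"
    by (rule subsetD[OF assms], rule imageI, rule lattice_1 lattice_self)+
  thus ?thesis using that by (auto simp: lattice_def)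
qed

lemma lattice_coords_unique:
  assumes "Im z \<noteq> 0" "of_int m + of_int n * z = of_int m' + of_int n' * z"
  shows "m = m' \<and> n = n'"
proof -
  have "of_int (m - m') + of_int (n - n') * z = 0" using assms(2) by (simp add: algebra_simps)
  from int_linear_relation_trivial[OF assms(1) this] show ?thesis by simp
qed

text \<open>The classical order of a primitive form. For \<open>\<alpha> = m + n z\<close>, reducing
  \<open>\<alpha> z\<close> by the quadratic equation shows that \<open>a\<close> divides
  \<open>n b\<close> and \<open>n c\<close>; it also divides \<open>n a\<close>, so coprimality of
  \<open>a, b, c\<close> makes it divide \<open>n\<close>.\<close>

lemma multiplier_ring_of_primitive_form:
  assumes "abc_of z a b c" "Im z > 0"
  shows "{\<alpha>. sc \<alpha> (lattice z) \<subseteq> lattice z} = lattice (of_int a * z)"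
proof (intro equalityI subsetI)
  have root: "of_int a * (z * z) = - of_int b * z - of_int c" and a: "a > 0"
    and g: "gcd a (gcd b c) = 1"
    using assms(1) by (auto simp: abc_of_def power2_eq_square algebra_simps eq_neg_iff_add_eq_0)
  {
    fix \<alpha> assume "\<alpha> \<in> {\<alpha>. sc \<alpha> (lattice z) \<subseteq> lattice z}"
    then obtain m n m' n' where mn: "\<alpha> = of_int m + of_int n * z" "\<alpha> * z = of_int m' + of_int n' * z"
      by (auto elim: lattice_multiplierE)
    have "of_int a * (\<alpha> * z) = of_int a * of_int m * z + of_int n * (of_int a * (z * z))"
      unfolding mn(1) by (simp add: algebra_simps)
    hence "of_int (- (n * c) - a * m') + of_int (a * m - n * b - a * n') * z = 0"
      unfolding root mn(2) by (simp add: algebra_simps)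
    hence "- (n * c) - a * m' = 0" "a * m - n * b - a * n' = 0"
      using int_linear_relation_trivial[of z] assms(2) by (metis less_irrefl)+
    hence "n * c = a * (- m')" "n * b = a * (m - n')" by (simp_all add: algebra_simps)
    moreover obtain p q r where "p * a + q * b + r * c = 1" using int_combination_1[OF g] by metis
    hence "n = n * (p * a + q * b + r * c)" by simp
    hence "n = a * (n * p) + q * (n * b) + r * (n * c)" by (simp add: algebra_simps)
    ultimately have "n = a * (n * p) + q * (a * (m - n')) + r * (a * (- m'))" by simp
    hence "a dvd n" by (metis dvd_add dvd_mult dvd_triv_left)
    then obtain k where "n = a * k" by (rule dvdE)
    hence "\<alpha> = of_int m + of_int k * (of_int a * z)" using mn(1) by simp
    thus "\<alpha> \<in> lattice (of_int a * z)" by (auto simp: lattice_def)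
  }
  fix \<alpha> assume "\<alpha> \<in> lattice (of_int a * z)"
  then obtain m n where al: "\<alpha> = of_int m + of_int n * (of_int a * z)" by (auto simp: lattice_def)
  have "\<alpha> * x \<in> lattice z" if xl: "x \<in> lattice z" for x
  proof -
    obtain s t where x: "x = of_int s + of_int t * z" using xl by (rule latticeE)
    have "\<alpha> * x = of_int (m * s) + of_int (m * t + n * a * s) * z + of_int (n * t) * (of_int a * (z * z))"
      unfolding al x by (simp add: algebra_simps)
    also have "\<dots> = of_int (m * s - n * t * c) + of_int (m * t + n * a * s - n * t * b) * z"
      unfolding root by (simp add: algebra_simps)
    finally show ?thesis unfolding lattice_def by blast
  qed
  thus "\<alpha> \<in> {\<alpha>. sc \<alpha> (lattice z) \<subseteq> lattice z}" by auto
qed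

context imag_quad
begin

lemma OK_lin [simp]: "of_int m + of_int n * \<omega> \<in> OK D"
  unfolding OK_iff by blast

lemma OK_E: assumes "x \<in> OK D" obtains m n where "x = of_int m + of_int n * \<omega>"
  using assms unfolding OK_iff by blast

lemma omod_lattice: assumes "has_CM D z" shows "omod (lattice z)"
  using assms unfolding has_CM_def omod_def by (auto intro: lattice_0 lattice_add)

text \<open>Both \<open>\<omega>\<close> and \<open>a z\<close> complete 1 to a basis of the same
  ring and lie in the upper half plane, so they differ by an integer. Hence \<open>2 a z + b\<close>
  is \<open>sqrtD D\<close> plus an integer, and that integer is 0 because the square of
  \<open>2 a z + b\<close> is the real number \<open>b^2 - 4 a c\<close>.\<close>

lemma CM_primitive_form:
  assumes "abc_of z a b c" "Im z > 0" "has_CM D z"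
  shows "2 * of_int a * z + of_int b = sqrtD D" "OK D = lattice (of_int a * z)"
proof -
  have a: "a > 0" and root: "of_int a * (z * z) = - of_int b * z - of_int c"
    using assms(1) by (auto simp: abc_of_def power2_eq_square algebra_simps eq_neg_iff_add_eq_0)
  show 1: "OK D = lattice (of_int a * z)"
    using multiplier_ring_of_primitive_form[OF assms(1,2)] assms(3) by (simp add: has_CM_def)
  have "of_int a * z \<in> lattice \<omega>" "\<omega> \<in> lattice (of_int a * z)"
    using 1 lattice_self[of \<omega>] lattice_self[of "of_int a * z"] by (simp_all add: OK_eq)
  then obtain r s r' s' where rs: "of_int a * z = of_int r + of_int s * \<omega>"
      "\<omega> = of_int r' + of_int s' * (of_int a * z)" by (meson latticeE)
  have s1: "of_int a * Im z = of_int s * Im \<omega>" using arg_cong[OF rs(1), of Im] by simp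
  have "Im \<omega> = of_int s' * (of_int a * Im z)" using arg_cong[OF rs(2), of Im] by simp
  hence "Im \<omega> = of_int (s' * s) * Im \<omega>" unfolding s1 by simp
  hence "real_of_int (s' * s) = 1" using Im_\<omega>_pos by (metis mult_cancel_right1 less_irrefl)
  hence "s' * s = 1" by linarith
  moreover have "real_of_int s * Im \<omega> > 0"
    using \<open>of_int a * Im z = of_int s * Im \<omega>\<close> a assms(2) by (metis mult_pos_pos of_int_0_less_iff)
  hence "s > 0" using Im_\<omega>_pos by (simp add: zero_less_mult_iff)
  ultimately have "s = 1" by (metis pos_zmult_eq_1_iff mult.commute)
  hence e: "2 * of_int a * z + of_int b = of_int (2 * r + D + b) + sqrtD D"
  proof -
    have "2 * of_int a * z + of_int b = 2 * (of_int a * z) + of_int b" by simp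
    also have "\<dots> = 2 * of_int r + 2 * \<omega> + of_int b" using rs(1) \<open>s = 1\<close> by simp
    finally show ?thesis unfolding two_\<omega> by simp
  qed
  have "(2 * of_int a * z + of_int b) * (2 * of_int a * z + of_int b)
      = 4 * of_int a * (of_int a * (z * z)) + 4 * of_int a * of_int b * z + of_int (b * b)"
    by (simp add: algebra_simps)
  also have "\<dots> = of_int (b * b - 4 * a * c)" unfolding root by (simp add: algebra_simps)
  finally have "Im ((of_int (2 * r + D + b) + sqrtD D) * (of_int (2 * r + D + b) + sqrtD D)) = 0"
    unfolding e by simp
  hence "of_int (2 * r + D + b) * Im (sqrtD D) = 0" by auto
  hence "real_of_int (2 * r + D + b) = 0" using Im_sqrtD_pos by auto
  hence "2 * r + D + b = 0" by (simp only: of_int_eq_0_iff)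
  thus "2 * of_int a * z + of_int b = sqrtD D" using e by simp
qed

text \<open>Multiplication by \<open>\<omega>\<close> preserves the lattice. Its matrix yields the
  quadratic equation, whose leading coefficient is nonzero as \<open>\<omega>\<close> is
  nonreal.\<close>

lemma ex_abc_of_CM:
  assumes "Im z > 0" "has_CM D z" shows "\<exists>a b c. abc_of z a b c"
proof -
  have "\<omega> \<in> {\<alpha>. sc \<alpha> (lattice z) \<subseteq> lattice z}" using assms(2) by (simp add: has_CM_def)
  then obtain m n m' n' where mn: "\<omega> = of_int m + of_int n * z" "\<omega> * z = of_int m' + of_int n' * z"
    by (auto elim: lattice_multiplierE)
  have "n \<noteq> 0" using mn(1) Im_\<omega>_pos by auto
  moreover have "of_int n * z\<^sup>2 + of_int (m - n') * z + of_int (- m') = 0"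
    using mn(2) unfolding mn(1) by (simp add: algebra_simps power2_eq_square)
  ultimately show ?thesis by (rule ex_primitive_quadratic)
qed

text \<open>Vieta's relations for \<open>z\<close> and its conjugate, cleared of the denominator
  \<open>a\<close>.\<close>

lemma CM_conj_relations:
  assumes "abc_of z a b c" "Im z > 0" "has_CM D z"
  shows "of_int a * cnj z = - of_int b - of_int a * z" "of_int a * (z * cnj z) = of_int c"
proof -
  have "cnj (2 * of_int a * z + of_int b) = - sqrtD D"
    unfolding CM_primitive_form[OF assms] by simp
  also have "\<dots> = - (2 * of_int a * z + of_int b)" unfolding CM_primitive_form[OF assms] ..
  finally have "2 * (of_int a * cnj z) = 2 * (- of_int b - of_int a * z)"
    by (simp add: algebra_simps eq_neg_iff_add_eq_0)
  thus 1: "of_int a * cnj z = - of_int b - of_int a * z" by (simp only: mult_cancel_left) simp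
  have "of_int a * (z * cnj z) = z * (of_int a * cnj z)" by simp
  also have "\<dots> = - (of_int a * z\<^sup>2 + of_int b * z + of_int c) + of_int c"
    unfolding 1 by (simp add: algebra_simps power2_eq_square)
  also have "\<dots> = of_int c" using assms(1) by (simp add: abc_of_def)
  finally show "of_int a * (z * cnj z) = of_int c" .
qed

text \<open>The fractional ideal \<open>\<int> + \<int> z\<close> has norm \<open>1 / a\<close>.
  After multiplication by \<open>a\<close>, the products of generators are \<open>a\<close>,
  \<open>a z\<close>, \<open>a cnj z\<close> and \<open>c\<close>, all in the ring of integers;
  conversely \<open>a\<close>, the trace \<open>- b\<close> and \<open>c\<close> are coprime and so
  produce 1.\<close>

lemma CM_lattice_norm:
  assumes "abc_of z a b c" "Im z > 0" "has_CM D z"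
  shows "ideal_mult (lattice z) (cnj ` lattice z) = principal D (1 / of_int a)"
proof
  have a: "a > 0" and g: "gcd a (gcd b c) = 1" using assms(1) by (auto simp: abc_of_def)
  note rel = CM_conj_relations[OF assms]
  let ?P = "principal D (1 / of_int a)"
  show "ideal_mult (lattice z) (cnj ` lattice z) \<subseteq> ?P"
  proof (rule ideal_mult_subset)
    fix x y assume "x \<in> lattice z" "y \<in> cnj ` lattice z"
    then obtain m n m' n' where x: "x = of_int m + of_int n * z"
      and y: "y = of_int m' + of_int n' * cnj z" by (auto simp: lattice_def)
    have "of_int a * (x * y) = of_int (a * m * m') + of_int (m * n') * (of_int a * cnj z)
        + of_int (n * m') * (of_int a * z) + of_int (n * n') * (of_int a * (z * cnj z))"
      unfolding x y by (simp add: algebra_simps)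
    also have "\<dots> = of_int (a * m * m' - m * n' * b + n * n' * c) + of_int (n * m' - m * n') * (of_int a * z)"
      unfolding rel by (simp add: algebra_simps)
    finally have "of_int a * (x * y) \<in> OK D"
      unfolding CM_primitive_form(2)[OF assms] lattice_def by blast
    moreover have "x * y = (1 / of_int a) * (of_int a * (x * y))" using a by simp
    ultimately show "x * y \<in> ?P" unfolding principal_def by blast
  qed (auto intro: omodD[OF omod_principal])
  let ?M = "ideal_mult (lattice z) (cnj ` lattice z)"
  have M: "omod ?M" by (intro omod_ideal_mult omod_lattice assms)
  have l: "1 \<in> cnj ` lattice z" "cnj z \<in> cnj ` lattice z"
    using lattice_1 lattice_self by force+
  have 1: "1 * 1 \<in> ?M" "z * 1 \<in> ?M" "1 * cnj z \<in> ?M" "z * cnj z \<in> ?M"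
    by (intro ideal_mult_prod lattice_1 lattice_self l)+
  obtain p q r where pqr: "p * a + q * b + r * c = 1" using int_combination_1[OF g] by metis
  have "of_int p * (1 * 1) + of_int (- q) * (z * 1 + 1 * cnj z) + of_int r * (z * cnj z) \<in> ?M"
    by (intro omodD(2)[OF M] omodD(3)[OF M OK_of_int] 1)
  also have "of_int p * (1 * 1) + of_int (- q) * (z * 1 + 1 * cnj z) + of_int r * (z * cnj z)
      = 1 / of_int a * (of_int p * of_int a + of_int (- q) * (of_int a * z + of_int a * cnj z)
         + of_int r * (of_int a * (z * cnj z)))" using a by (simp add: field_simps)
  also have "\<dots> = 1 / of_int a * of_int (p * a + q * b + r * c)"
    unfolding rel by (simp add: algebra_simps)
  finally have 2: "1 / of_int a \<in> ?M" unfolding pqr by simp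
  show "?P \<subseteq> ?M"
    unfolding principal_def using omodD(3)[OF M _ 2] by (auto simp: mult.commute)
qed

text \<open>Hermite normal form: \<open>A\<close> is the least positive integer in the ideal and
  \<open>C\<close> the least positive \<open>\<omega>\<close>-coordinate of an element. Both exist
  because the ideal contains the norm \<open>N\<close> of a nonzero element together with
  \<open>N \<omega>\<close>; division with remainder does the rest.\<close>

lemma int_ideal_basis:
  assumes "int_ideal D I"
  obtains A B C :: int where "A > 0" "C > 0"
    "I = {of_int m * of_int A + of_int n * (of_int B + of_int C * \<omega>) | m n. True}"
proof -
  have I: "omod I" "I \<subseteq> OK D" using assms by (auto simp: int_ideal_iff)
  note ID = omodD[OF I(1)]
  obtain x where "x \<in> I" "x \<noteq> 0" using assms by (rule int_ideal_nz)
  then obtain N where N: "N > 0" "x * cnj x = of_int N" using OK_norm I by (metis subsetD)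
  have NI: "of_int N \<in> I" using ID(3)[of "cnj x" x] OK_cnj \<open>x \<in> I\<close> I N(2) by (metis mult.commute subsetD)
  have N\<omega>: "of_int 0 + of_int N * \<omega> \<in> I" using ID(3)[OF OK_\<omega> NI] by (simp add: mult.commute)
  define P where "P k \<longleftrightarrow> k > 0 \<and> (\<exists>m. of_int m + of_int (int k) * \<omega> \<in> I)" for k :: nat
  define Q where "Q k \<longleftrightarrow> k > 0 \<and> of_int (int k) \<in> I" for k :: nat
  have "P (nat N)" "Q (nat N)" using N NI N\<omega> unfolding P_def Q_def by (auto intro!: exI[of _ 0])
  hence LP: "P (LEAST k. P k)" "\<And>k. P k \<Longrightarrow> (LEAST k. P k) \<le> k"
    and LQ: "Q (LEAST k. Q k)" "\<And>k. Q k \<Longrightarrow> (LEAST k. Q k) \<le> k"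
    by (auto intro: LeastI Least_le)
  define A where "A = int (LEAST k. Q k)"
  define C where "C = int (LEAST k. P k)"
  have A: "A > 0" "of_int A \<in> I" using LQ(1) unfolding Q_def A_def by auto
  obtain B where C: "C > 0" "of_int B + of_int C * \<omega> \<in> I" using LP(1) unfolding P_def C_def by auto
  have "I = {of_int m * of_int A + of_int n * (of_int B + of_int C * \<omega>) | m n. True}"
  proof (intro equalityI subsetI)
    fix y assume "y \<in> I"
    then obtain m n where y: "y = of_int m + of_int n * \<omega>" using I(2) by (meson OK_E subsetD)
    define n' where "n' = n div C"
    have "y - of_int n' * (of_int B + of_int C * \<omega>) \<in> I"
      using \<open>y \<in> I\<close> C by (intro ID(5) ID(3) OK_of_int)
    also have "y - of_int n' * (of_int B + of_int C * \<omega>) = of_int (m - n' * B) + of_int (n - n' * C) * \<omega>"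
      unfolding y by (simp add: algebra_simps)
    also have "n - n' * C = n mod C" by (simp add: n'_def minus_div_mult_eq_mod)
    finally have y2: "of_int (m - n' * B) + of_int (n mod C) * \<omega> \<in> I" .
    have "n mod C = 0"
    proof (rule ccontr)
      assume "n mod C \<noteq> 0"
      hence "n mod C > 0" "n mod C < C"
        using C(1) pos_mod_bound[of C n] pos_mod_sign[of C n] by linarith+
      hence "P (nat (n mod C))" unfolding P_def using y2
        by (auto intro: exI[of _ "m - n' * B"])
      hence "C \<le> n mod C" using LP(2) \<open>n mod C > 0\<close> unfolding C_def by fastforce
      thus False using \<open>n mod C < C\<close> by simp
    qed
    define k where "k = m - n' * B"
    have kI: "of_int k \<in> I" using y2 \<open>n mod C = 0\<close> by (simp add: k_def)
    have "of_int k - of_int (k div A) * of_int A \<in> I"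
      using kI A by (intro ID(5) ID(3) OK_of_int)
    also have "of_int k - of_int (k div A) * of_int A = (of_int (k - k div A * A) :: complex)" by simp
    also have "k - k div A * A = k mod A" by (rule minus_div_mult_eq_mod)
    finally have k2: "of_int (k mod A) \<in> I" .
    have "k mod A = 0"
    proof (rule ccontr)
      assume "k mod A \<noteq> 0"
      hence "k mod A > 0" "k mod A < A"
        using A(1) pos_mod_bound[of A k] pos_mod_sign[of A k] by linarith+
      hence "Q (nat (k mod A))" unfolding Q_def using k2 by auto
      hence "A \<le> k mod A" using LQ(2) \<open>k mod A > 0\<close> unfolding A_def by fastforce
      thus False using \<open>k mod A < A\<close> by simp
    qed
    hence "k = k div A * A" "n = n' * C" using \<open>n mod C = 0\<close> unfolding n'_def by auto
    hence km: "m = k div A * A + n' * B" unfolding k_def by (simp add: algebra_simps)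
    have "y = of_int (k div A) * of_int A + of_int n' * (of_int B + of_int C * \<omega>)"
      unfolding y by (subst km, subst \<open>n = n' * C\<close>) (simp add: algebra_simps)
    thus "y \<in> {of_int m * of_int A + of_int n * (of_int B + of_int C * \<omega>) | m n. True}" by blast
  qed (use A C in \<open>auto intro!: ID(2,3)\<close>)
  thus ?thesis using A(1) C(1) by (rule that[rotated 2])
qed

text \<open>The numbers \<open>i + j \<omega>\<close> with \<open>0 \<le> i < A\<close> and
  \<open>0 \<le> j < C\<close> form a complete residue system: the second coordinate is reduced by
  \<open>B + C \<omega>\<close>, then the first by \<open>A\<close>.\<close>

lemma ideal_norm_basis:
  fixes A B C :: int
  assumes "A > 0" "C > 0" and I: "I = {of_int m * of_int A + of_int n * (of_int B + of_int C * \<omega>) | m n. True}"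
    and "int_ideal D I"
  shows "ideal_norm D I = nat (A * C)"
proof -
  have oI: "omod I" "I \<subseteq> OK D" using assms(4) by (auto simp: int_ideal_iff)
  note ID = omodD[OF oI(1)]
  define R where "R = {(x, y). x \<in> OK D \<and> y \<in> OK D \<and> x - y \<in> I}"
  have "equiv (OK D) R"
  proof (rule equivI)
    show "sym R" unfolding sym_def R_def using ID(4) by fastforce
    show "trans R" unfolding trans_def R_def using ID(2) by fastforce
  qed (auto simp: R_def refl_on_def ID)
  define g where "g = (\<lambda>(i, j). R `` {of_int i + of_int j * \<omega>})"
  have memI: "of_int m + of_int n * \<omega> \<in> I \<longleftrightarrow> C dvd n \<and> A dvd m - n div C * B" for m n
  proof
    assume "of_int m + of_int n * \<omega> \<in> I"
    then obtain s t where "of_int m + of_int n * \<omega> = of_int s * of_int A + of_int t * (of_int B + of_int C * \<omega>)"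
      unfolding I by auto
    hence "of_int m + of_int n * \<omega> = of_int (s * A + t * B) + of_int (t * C) * \<omega>" by (simp add: algebra_simps)
    hence "m = s * A + t * B" "n = t * C" using lattice_coords_unique Im_\<omega>_pos by (metis less_irrefl)+
    thus "C dvd n \<and> A dvd m - n div C * B" using assms(2) by auto
  next
    assume "C dvd n \<and> A dvd m - n div C * B"
    then obtain t s where "n = C * t" "m - n div C * B = A * s" by (meson dvdE)
    hence "n = C * t" "m = A * s + t * B" using assms(2) by auto
    hence "of_int m + of_int n * \<omega> = of_int s * of_int A + of_int t * (of_int B + of_int C * \<omega>)"
      by (simp add: algebra_simps)
    thus "of_int m + of_int n * \<omega> \<in> I" unfolding I by blast
  qed
  have "inj_on g ({0..<A} \<times> {0..<C})"
  proof (rule inj_onI, clarify)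
    fix i j i' j' assume ij: "i \<in> {0..<A}" "j \<in> {0..<C}" "i' \<in> {0..<A}" "j' \<in> {0..<C}"
      and "g (i, j) = g (i', j')"
    hence "(of_int i + of_int j * \<omega>, of_int i' + of_int j' * \<omega>) \<in> R"
      using \<open>equiv _ _\<close> unfolding g_def prod.case
      by (subst (asm) eq_equiv_class_iff[OF \<open>equiv _ _\<close>]) auto
    hence "of_int (i - i') + of_int (j - j') * \<omega> \<in> I" unfolding R_def by (simp add: algebra_simps)
    hence *: "C dvd j - j'" "A dvd i - i' - (j - j') div C * B" unfolding memI by auto
    have "j = j'" using *(1) ij(2,4) by (auto dest!: zdvd_imp_le[rotated] simp: mod_eq_dvd_iff[symmetric])
    hence "A dvd i - i'" using *(2) by simp
    hence "i = i'" using ij(1,3) by (auto simp: mod_eq_dvd_iff[symmetric])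
    thus "i = i' \<and> j = j'" using \<open>j = j'\<close> by simp
  qed
  moreover have "OK D // R = g ` ({0..<A} \<times> {0..<C})"
  proof (intro equalityI subsetI)
    fix X assume "X \<in> OK D // R"
    then obtain x where x: "x \<in> OK D" "X = R `` {x}" by (auto elim: quotientE)
    then obtain m n where mn: "x = of_int m + of_int n * \<omega>" by (auto simp: OK_iff)
    define j where "j = n mod C"
    define k where "k = m - n div C * B"
    define i where "i = k mod A"
    have nj: "n - j = C * (n div C)" by (simp add: j_def minus_mod_eq_mult_div)
    hence "(n - j) div C = n div C" using assms(2) by simp
    hence "m - i - (n - j) div C * B = k - k mod A" by (simp add: i_def k_def)
    hence "of_int (m - i) + of_int (n - j) * \<omega> \<in> I" unfolding memI using nj
      by (simp add: minus_mod_eq_mult_div)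
    hence "(x, of_int i + of_int j * \<omega>) \<in> R" using x(1) unfolding R_def mn
      by (auto simp: algebra_simps)
    hence "X = g (i, j)" unfolding g_def prod.case x(2)
      by (rule equiv_class_eq[OF \<open>equiv _ _\<close>])
    moreover have "(i, j) \<in> {0..<A} \<times> {0..<C}" using assms(1,2) by (auto simp: i_def j_def)
    ultimately show "X \<in> g ` ({0..<A} \<times> {0..<C})" by blast
  qed (auto simp: g_def intro!: quotientI)
  ultimately have "card (OK D // R) = card ({0..<A} \<times> {0..<C})" by (simp add: card_image)
  thus ?thesis using assms(1,2) unfolding ideal_norm_def R_def
    by (simp add: card_cartesian_product nat_mult_distrib)
qed

text \<open>Multipliers of a lattice satisfy a monic integral quadratic equation, so no order larger than
  \<open>OK D\<close> can occur as the multiplier ring of an ideal.\<close>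

lemma int_ideal_CM_lattice:
  assumes "int_ideal D I"
  obtains w A where "A > 0" "Im w > 0" "has_CM D w" "I = sc (of_int A) (lattice w)"
    "of_nat (ideal_norm D I) * Im \<omega> = of_int A * (of_int A * Im w)"
proof -
  obtain A B C where ABC: "A > 0" "C > 0"
    and I: "I = {of_int m * of_int A + of_int n * (of_int B + of_int C * \<omega>) | m n. True}"
    using int_ideal_basis[OF assms] by metis
  define w where "w = (of_int B + of_int C * \<omega>) / of_int A"
  have Aw: "of_int A * w = of_int B + of_int C * \<omega>" using ABC by (simp add: w_def)
  have IL: "I = sc (of_int A) (lattice w)"
  proof (intro equalityI subsetI)
    fix x assume "x \<in> I"
    then obtain m n where "x = of_int m * of_int A + of_int n * (of_int B + of_int C * \<omega>)"
      unfolding I by auto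
    hence "x = of_int A * (of_int m + of_int n * w)" unfolding Aw[symmetric] by (simp add: algebra_simps)
    thus "x \<in> sc (of_int A) (lattice w)" by (auto simp: lattice_def)
  next
    fix x assume "x \<in> sc (of_int A) (lattice w)"
    then obtain m n where "x = of_int A * (of_int m + of_int n * w)" by (auto simp: lattice_def)
    hence "x = of_int m * of_int A + of_int n * (of_int A * w)" by (simp add: algebra_simps)
    thus "x \<in> I" unfolding Aw I by blast
  qed
  \<comment> \<open>Imaginary parts measure covolumes here; with the index \<open>A * C\<close> this
    identity yields the last claim.\<close>
  have Imw: "of_int A * Im w = of_int C * Im \<omega>" using arg_cong[OF Aw, of Im] by simp
  hence "Im w > 0" using ABC Im_\<omega>_pos
    by (metis mult_pos_pos of_int_0_less_iff zero_less_mult_pos)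
  have oI: "omod I" using assms by (auto simp: int_ideal_iff)
  have "has_CM D w" unfolding has_CM_def
  proof (intro equalityI subsetI)
    fix \<alpha> assume "\<alpha> \<in> {\<alpha>. sc \<alpha> (lattice w) \<subseteq> lattice w}"
    then obtain m n m' n' where mn: "\<alpha> = of_int m + of_int n * w" "\<alpha> * w = of_int m' + of_int n' * w"
      by (auto elim: lattice_multiplierE)
    have "\<alpha> * \<alpha> = of_int m * \<alpha> + of_int n * (\<alpha> * w)" by (subst (2) mn(1)) (simp add: algebra_simps)
    also have "\<dots> = of_int m * \<alpha> + of_int n * of_int m' + of_int n' * (\<alpha> - of_int m)"
      unfolding mn(2) by (subst (2) mn(1)) (simp add: algebra_simps)
    finally have "\<alpha>\<^sup>2 + of_int (- m - n') * \<alpha> + of_int (m * n' - n * m') = 0"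
      by (simp add: algebra_simps power2_eq_square)
    hence "alg_int \<alpha>" by (rule alg_int_quadratic)
    moreover have "\<alpha> = of_real (of_rat (of_int m + of_int n * (of_int B + of_int C * of_int D / 2) / of_int A))
        + of_real (of_rat (of_int n * of_int C / (2 * of_int A))) * sqrtD D"
    proof -
      have "\<alpha> = of_int m + of_int n * (of_int B + of_int C * (of_int D + sqrtD D) / 2) / of_int A"
        unfolding mn(1) w_def \<omega>_def by simp
      thus ?thesis using ABC by (simp add: of_rat_add of_rat_mult of_rat_divide field_simps)
    qed
    hence "\<alpha> \<in> Kfield D" unfolding Kfield_def by blast
    ultimately show "\<alpha> \<in> OK D" by (simp add: OK_def)
  next
    fix \<alpha> assume "\<alpha> \<in> OK D"
    have "\<alpha> * x \<in> lattice w" if "x \<in> lattice w" for x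
    proof -
      have "of_int A * x \<in> I" unfolding IL using that by blast
      hence "\<alpha> * (of_int A * x) \<in> I" using \<open>\<alpha> \<in> OK D\<close> by (rule omodD(3)[OF oI, rotated])
      then obtain y where "y \<in> lattice w" "\<alpha> * (of_int A * x) = of_int A * y" unfolding IL by auto
      thus ?thesis using ABC by (simp add: mult.left_commute)
    qed
    thus "\<alpha> \<in> {\<alpha>. sc \<alpha> (lattice w) \<subseteq> lattice w}" by auto
  qed
  moreover have "of_nat (ideal_norm D I) * Im \<omega> = of_int A * (of_int A * Im w)"
    using ideal_norm_basis[OF ABC I assms] ABC Imw by simp
  ultimately show ?thesis using that ABC(1) \<open>Im w > 0\<close> IL by blast
qed

text \<open>This makes the conjugate an inverse up to scaling. The product is generated by
  \<open>A^2 / a\<close>, by the norm of the lattice of \<open>w\<close>, while the residue class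
  count is the covolume quotient \<open>A^2 Im w / Im \<omega>\<close>; the two agree because
  \<open>Im \<omega> = a * Im w\<close>.\<close>

lemma ideal_mult_cnj:
  assumes "int_ideal D I"
  shows "ideal_mult I (cnj ` I) = principal D (of_nat (ideal_norm D I))" "ideal_norm D I > 0"
proof -
  obtain w A where w: "A > 0" "Im w > 0" "has_CM D w" "I = sc (of_int A) (lattice w)"
    and n: "of_nat (ideal_norm D I) * Im \<omega> = of_int A * (of_int A * Im w)"
    using int_ideal_CM_lattice[OF assms] by metis
  obtain a b c where abc: "abc_of w a b c" using ex_abc_of_CM[OF w(2,3)] by blast
  hence a: "a > 0" by (auto simp: abc_of_def)
  have "2 * (of_int a * Im w) = 2 * Im \<omega>"
    using arg_cong[OF CM_primitive_form(1)[OF abc w(2,3)], of Im] arg_cong[OF two_\<omega>, of Im] by simp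
  hence "Im \<omega> = of_int a * Im w" by simp
  hence "of_nat (ideal_norm D I) * of_int a * Im w = of_int A * of_int A * Im w"
    using n by simp
  hence na: "of_nat (ideal_norm D I) * real_of_int a = of_int A * of_int A" using w(2) by simp
  moreover have "real_of_int A * of_int A > 0" using w(1) by simp
  ultimately show "ideal_norm D I > 0" by (metis gr0I mult_zero_left of_nat_0 less_irrefl)
  have "complex_of_real (of_nat (ideal_norm D I) * real_of_int a) = of_real (of_int A * of_int A)"
    using na by simp
  hence nc: "of_int A * of_int A * (1 / of_int a) = complex_of_nat (ideal_norm D I)"
    using a by (simp add: field_simps)
  have "ideal_mult I (cnj ` I) = sc (of_int A * of_int A) (ideal_mult (lattice w) (cnj ` lattice w))"
    unfolding w(4) cnj_sc ideal_mult_sc ideal_mult_sc_right sc_sc by simp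
  also have "\<dots> = principal D (of_int A * of_int A * (1 / of_int a))"
    unfolding CM_lattice_norm[OF abc w(2,3)] principal_def sc_sc ..
  finally show "ideal_mult I (cnj ` I) = principal D (of_nat (ideal_norm D I))" unfolding nc .
qed

end

section \<open>Norms and ideal classes\<close>

lemma primitive_form_represents_coprime:
  fixes a b c n :: int
  assumes g: "gcd a (gcd b c) = 1" and "n \<noteq> 0"
  obtains u v where "u \<noteq> 0" "coprime (a * u\<^sup>2 + b * u * v + c * v\<^sup>2) n"
proof -
  \<comment> \<open>Prescribe \<open>(u, v)\<close> modulo each prime \<open>p | n\<close>: \<open>(*, 0)\<close> if \<open>p\<close> does not divide \<open>a\<close>, else \<open>(0, *)\<close> if \<open>p\<close>
    does not divide \<open>c\<close>, else \<open>(*, *)\<close>, where \<open>*\<close> is nonzero; in the last case \<open>p\<close> does not divide \<open>b\<close>.\<close>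
  define S where "S = prime_factors n"
  have fin: "finite S" and pr: "\<And>p. p \<in> S \<Longrightarrow> prime p" by (auto simp: S_def)
  define U where "U = {p \<in> S. p dvd a \<and> \<not> p dvd c}"
  define V where "V = {p \<in> S. \<not> p dvd a}"
  define u where "u = \<Prod>U"
  define v where "v = \<Prod>V"
  have dvd_iff: "p dvd \<Prod>W \<longleftrightarrow> p \<in> W" if "W \<subseteq> S" "p \<in> S" for p W
  proof -
    have W: "finite W" using that fin finite_subset by blast
    have "p dvd \<Prod>W \<longleftrightarrow> (\<exists>q\<in>W. p dvd q)"
      using prime_dvd_prod_iff[OF W, of p "\<lambda>x. x"] pr[OF that(2)] by simp
    also have "\<dots> \<longleftrightarrow> p \<in> W" using that pr primes_dvd_imp_eq by (metis dvd_refl subsetD)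
    finally show ?thesis .
  qed
  have "0 \<notin> S" using pr not_prime_0 by blast
  hence "u \<noteq> 0" unfolding u_def using fin by (simp add: U_def)
  moreover have "coprime (a * u\<^sup>2 + b * u * v + c * v\<^sup>2) n"
  proof (rule ccontr)
    assume "\<not> coprime (a * u\<^sup>2 + b * u * v + c * v\<^sup>2) n"
    hence "\<bar>gcd (a * u\<^sup>2 + b * u * v + c * v\<^sup>2) n\<bar> \<noteq> 1" by (simp add: coprime_iff_gcd_eq_1)
    from prime_factor_int[OF this] obtain p
      where p: "prime p" "p dvd a * u\<^sup>2 + b * u * v + c * v\<^sup>2" "p dvd n" by auto
    have pS: "p \<in> S" using p assms(2) by (simp add: S_def in_prime_factors_iff)
    have pu: "p dvd u \<longleftrightarrow> p dvd a \<and> \<not> p dvd c" unfolding u_def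
      using dvd_iff[OF _ pS, of U] pS by (auto simp: U_def)
    have pv: "p dvd v \<longleftrightarrow> \<not> p dvd a" unfolding v_def
      using dvd_iff[OF _ pS, of V] pS by (auto simp: V_def)
    note pm = prime_dvd_mult_iff[OF p(1)] prime_dvd_power_iff[OF p(1)]
    consider "\<not> p dvd a" | "p dvd a" "\<not> p dvd c" | "p dvd a" "p dvd c" by blast
    thus False
    proof cases
      case 1
      hence "p dvd b * u * v + c * v\<^sup>2" using pv by (auto simp: power2_eq_square)
      hence "p dvd a * u\<^sup>2" using p(2) by (metis add.assoc dvd_add_left_iff)
      thus False using 1 pu pm by (auto simp: power2_eq_square)
    next
      case 2
      hence "p dvd a * u\<^sup>2 + b * u * v" using pu by auto
      hence "p dvd c * v\<^sup>2" using p(2) by (metis dvd_add_right_iff)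
      thus False using 2 pv pm by (auto simp: power2_eq_square)
    next
      case 3
      hence "p dvd a * u\<^sup>2" "p dvd c * v\<^sup>2" by auto
      hence "p dvd b * u * v" using p(2) by (metis dvd_add_right_iff dvd_add_left_iff)
      hence "p dvd b" using 3 pu pv pm by auto
      hence "p dvd gcd a (gcd b c)" using 3 by simp
      thus False using g p(1) by auto
    qed
  qed
  ultimately show ?thesis by (rule that)
qed

context imag_quad
begin

lemma OK_cmod_ge_1: assumes "x \<in> OK D" "x \<noteq> 0" shows "cmod x \<ge> 1"
proof -
  obtain n where n: "n > 0" "x * cnj x = of_int n" using OK_norm[OF assms] by metis
  have "complex_of_real ((cmod x)\<^sup>2) = of_real (of_int n)"
    using n by (simp only: complex_norm_square) simp
  hence "(cmod x)\<^sup>2 = of_int n" by (simp only: of_real_eq_iff)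
  hence "(cmod x)\<^sup>2 \<ge> 1" using n(1) by simp
  thus ?thesis by (simp add: power2_nonneg_ge_1_iff)
qed

lemma principal_subset_cmod:
  assumes "principal D a \<subseteq> principal D b" "a \<noteq> 0" shows "cmod b \<le> cmod a"
proof -
  have "a \<in> principal D b" using assms in_principal by blast
  then obtain x where x: "x \<in> OK D" "a = b * x" by (auto simp: principal_def)
  hence "x \<noteq> 0" using assms by auto
  hence "cmod b * 1 \<le> cmod b * cmod x" using OK_cmod_ge_1[OF x(1)] by (intro mult_left_mono) auto
  thus ?thesis unfolding x(2) by (simp add: norm_mult)
qed

lemma principal_0: "principal D 0 = {0}"
proof -
  have "OK D \<noteq> {}" using OK_0 by blast
  thus ?thesis by (simp add: principal_def image_constant_conv)
qed

text \<open>Nonzero elements of the ring of integers have absolute value at least 1, so mutual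
  divisibility fixes the absolute value. This turns identities of principal ideals into numerical
  identities of norms.\<close>

lemma principal_eq_cmod:
  assumes "principal D a = principal D b" shows "cmod a = cmod b"
proof (cases "a = 0 \<or> b = 0")
  case True
  hence "a = 0 \<and> b = 0" using assms in_principal[of a] in_principal[of b] principal_0 by fast
  thus ?thesis by simp
next
  case False
  thus ?thesis using assms principal_subset_cmod[of a b] principal_subset_cmod[of b a] by auto
qed

lemma ideal_norm_eqI:
  assumes "int_ideal D I" "ideal_mult I (cnj ` I) = principal D a"
  shows "real (ideal_norm D I) = cmod a"
  using principal_eq_cmod[of "of_nat (ideal_norm D I)" a] ideal_mult_cnj(1)[OF assms(1)] assms(2)
  by simp

lemma ideal_norm_mult:
  assumes "int_ideal D I" "int_ideal D J"
  shows "ideal_norm D (ideal_mult I J) = ideal_norm D I * ideal_norm D J"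
proof -
  have "ideal_mult (ideal_mult I J) (cnj ` ideal_mult I J)
      = ideal_mult (ideal_mult I (cnj ` I)) (ideal_mult J (cnj ` J))"
    unfolding cnj_ideal_mult by (metis ideal_mult_assoc ideal_mult_commute)
  also have "\<dots> = principal D (of_nat (ideal_norm D I * ideal_norm D J))"
    unfolding ideal_mult_cnj[OF assms(1)] ideal_mult_cnj[OF assms(2)] principal_mult_principal by simp
  finally have "real (ideal_norm D (ideal_mult I J)) = real (ideal_norm D I * ideal_norm D J)"
    using ideal_norm_eqI[OF int_ideal_mult[OF assms]] by (metis norm_of_nat)
  thus ?thesis by (simp only: of_nat_eq_iff)
qed

lemma ideal_norm_principal:
  assumes "y \<in> OK D" "y \<noteq> 0" shows "real (ideal_norm D (principal D y)) = (cmod y)\<^sup>2"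
  using ideal_norm_eqI[OF int_ideal_principal[OF assms], of "y * cnj y"]
  by (simp add: cnj_principal principal_mult_principal norm_mult power2_eq_square)

lemma ideal_norm_OK: "ideal_norm D (OK D) = 1"
  using ideal_norm_principal[of 1] by (simp add: principal_1)

section \<open>Cancellation, and division of a principal ideal by an ideal\<close>

lemma ideal_mult_cnj_cancel:
  assumes "int_ideal D K" "omod I"
  shows "ideal_mult (ideal_mult I K) (cnj ` K) = sc (of_nat (ideal_norm D K)) I"
proof -
  have "ideal_mult (ideal_mult I K) (cnj ` K) = ideal_mult (ideal_mult K (cnj ` K)) I"
    by (metis ideal_mult_assoc ideal_mult_commute)
  thus ?thesis unfolding ideal_mult_cnj(1)[OF assms(1)] principal_mult[OF assms(2)] .
qed

lemma ideal_mult_cancel: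
  assumes "int_ideal D K" "omod I" "omod J" "ideal_mult I K = ideal_mult J K"
  shows "I = J"
proof -
  have "sc (of_nat (ideal_norm D K)) I = sc (of_nat (ideal_norm D K)) J"
    using ideal_mult_cnj_cancel[OF assms(1,2)] ideal_mult_cnj_cancel[OF assms(1,3)] assms(4) by simp
  moreover have "of_nat (ideal_norm D K) \<noteq> (0 :: complex)" using ideal_mult_cnj(2)[OF assms(1)] by simp
  ultimately show ?thesis by (rule sc_cancel[rotated])
qed

text \<open>The integral ideal \<open>y T\<^sup>-\<^sup>1\<close>, for nonzero \<open>y \<in> T\<close>.\<close>

definition quo :: "complex set \<Rightarrow> complex \<Rightarrow> complex set" where
  "quo T y = sc (y / of_nat (ideal_norm D T)) (cnj ` T)"

text \<open>Integrality holds since \<open>y * cnj t\<close> lies in the product of \<open>T\<close>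
  with its conjugate, which is generated by the very norm that \<open>quo\<close> divides
  by.\<close>

lemma quo_props:
  assumes "int_ideal D T" "y \<in> T" "y \<noteq> 0"
  shows "int_ideal D (quo T y)" "ideal_mult (quo T y) T = principal D y"
proof -
  let ?n = "ideal_norm D T"
  have n: "?n > 0" by (rule ideal_mult_cnj(2)[OF assms(1)])
  have T: "omod T" "T \<subseteq> OK D" using assms(1) by (auto simp: int_ideal_iff)
  show 2: "ideal_mult (quo T y) T = principal D y"
  proof -
    have "ideal_mult (quo T y) T = sc (y / of_nat ?n) (ideal_mult T (cnj ` T))"
      unfolding quo_def ideal_mult_sc by (simp add: ideal_mult_commute)
    also have "\<dots> = principal D (y / of_nat ?n * of_nat ?n)"
      unfolding ideal_mult_cnj(1)[OF assms(1)] principal_def sc_sc ..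
    finally show ?thesis using n by simp
  qed
  have "quo T y \<subseteq> OK D"
  proof
    fix x assume "x \<in> quo T y"
    then obtain t where t: "t \<in> T" "x = y / of_nat ?n * cnj t" by (auto simp: quo_def)
    have "y * cnj t \<in> ideal_mult T (cnj ` T)" using t assms by (intro ideal_mult_prod) auto
    then obtain r where "r \<in> OK D" "y * cnj t = of_nat ?n * r"
      unfolding ideal_mult_cnj(1)[OF assms(1)] by (auto simp: principal_def)
    thus "x \<in> OK D" using t n by simp
  qed
  moreover have "quo T y \<noteq> {0}"
  proof
    assume "quo T y = {0}"
    have "y / of_nat ?n * cnj y \<in> quo T y" using assms by (auto simp: quo_def)
    thus False using assms n \<open>quo T y = {0}\<close> by auto
  qed
  moreover have "omod (quo T y)" unfolding quo_def by (intro omod_sc omod_cnj T)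
  ultimately show "int_ideal D (quo T y)" by (auto simp: int_ideal_iff)
qed

text \<open>The generator lies in \<open>T\<close> because \<open>I T \<subseteq> T\<close>, and
  cancelling \<open>T\<close> identifies \<open>I\<close>. Together with \<open>quo_props\<close>,
  this parametrises the integral ideals \<open>I\<close> with \<open>I T\<close> principal by the
  nonzero elements of \<open>T\<close>.\<close>

lemma quo_unique:
  assumes "int_ideal D T" "int_ideal D I" "ideal_mult I T = principal D y"
  shows "y \<in> T" "y \<noteq> 0" "I = quo T y"
proof -
  have "ideal_mult I T \<subseteq> T"
    using ideal_mult_subset_left[OF assms(1), of I] assms(2) by (auto simp: int_ideal_iff ideal_mult_commute)
  thus yT: "y \<in> T" using assms(3) in_principal by blast
  show y0: "y \<noteq> 0"
    using int_ideal_mult[OF assms(2,1)] assms(3) principal_0 by (auto simp: int_ideal_iff)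
  show "I = quo T y"
    using ideal_mult_cancel[OF assms(1), of I "quo T y"] quo_props[OF assms(1) yT y0] assms
    by (auto simp: int_ideal_iff)
qed

lemma ideal_norm_quo:
  assumes "int_ideal D T" "y \<in> T" "y \<noteq> 0"
  shows "real (ideal_norm D (quo T y)) * real (ideal_norm D T) = (cmod y)\<^sup>2"
proof -
  have "y \<in> OK D" using assms by (auto simp: int_ideal_iff)
  thus ?thesis
    using ideal_norm_mult[OF quo_props(1)[OF assms] assms(1)] quo_props(2)[OF assms]
      ideal_norm_principal[of y] assms(3) by simp
qed

lemma ideal_norm_mem: assumes "int_ideal D I" shows "of_nat (ideal_norm D I) \<in> I"
proof -
  have "of_nat (ideal_norm D I) \<in> ideal_mult I (cnj ` I)"
    unfolding ideal_mult_cnj[OF assms] by (rule in_principal)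
  moreover have "ideal_mult I (cnj ` I) \<subseteq> I"
    using ideal_mult_subset_left[OF assms] int_ideal_cnj[OF assms] by (auto simp: int_ideal_iff)
  ultimately show ?thesis by blast
qed

text \<open>An ideal contains its own norm, so a Bezout relation between the norms splits 1.\<close>

lemma coprime_norms_imp_ideal_coprime:
  assumes "int_ideal D I" "int_ideal D J" "coprime (ideal_norm D I) (ideal_norm D J)"
  shows "ideal_coprime I J"
proof -
  have "gcd (int (ideal_norm D I)) (int (ideal_norm D J)) = 1" using assms(3) by simp
  then obtain u v where uv: "u * int (ideal_norm D I) + v * int (ideal_norm D J) = 1"
    using bezout_int by metis
  have "of_int u * of_nat (ideal_norm D I) \<in> I" "of_int v * of_nat (ideal_norm D J) \<in> J"
    using assms(1,2) ideal_norm_mem omodD(3) OK_of_int by (meson int_ideal_iff)+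
  moreover have "of_int u * of_nat (ideal_norm D I) + of_int v * of_nat (ideal_norm D J) = (1 :: complex)"
    using arg_cong[OF uv, of complex_of_int] by simp
  ultimately show ?thesis unfolding ideal_coprime_def by blast
qed

lemma ideal_coprime_mult_iff:
  assumes "int_ideal D I" "int_ideal D J" "int_ideal D c"
  shows "ideal_coprime (ideal_mult I J) c \<longleftrightarrow> ideal_coprime I c \<and> ideal_coprime J c"
proof
  assume "ideal_coprime (ideal_mult I J) c"
  moreover have "ideal_mult I J \<subseteq> I" "ideal_mult I J \<subseteq> J"
    using assms ideal_mult_subset_left[of I J] ideal_mult_subset_left[of J I]
    by (auto simp: int_ideal_iff ideal_mult_commute)
  ultimately show "ideal_coprime I c \<and> ideal_coprime J c" unfolding ideal_coprime_def by blast
next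
  assume "ideal_coprime I c \<and> ideal_coprime J c"
  then obtain x y x' y' where *: "x \<in> I" "y \<in> c" "x + y = 1" "x' \<in> J" "y' \<in> c" "x' + y' = 1"
    unfolding ideal_coprime_def by auto
  have c: "omod c" and "x \<in> OK D" using assms * by (auto simp: int_ideal_iff)
  hence "x * y' + y \<in> c" using * by (intro omodD(2)[OF c] omodD(3)[OF c])
  moreover have "x * x' \<in> ideal_mult I J" using * by (intro ideal_mult_prod)
  moreover have "x * x' + (x * y' + y) = 1"
    using *(3,6) by (metis add.assoc distrib_left mult.right_neutral)
  ultimately show "ideal_coprime (ideal_mult I J) c" unfolding ideal_coprime_def by blast
qed

text \<open>For \<open>x = A (u + v w)\<close> in \<open>T\<close>, the norm of
  \<open>x T^-1\<close> is the value at \<open>(u, v)\<close> of a primitive form, so norms prime to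
  \<open>n\<close> are available. Taking for \<open>n\<close> the norm of a conductor, this supplies
  an ideal of a prescribed class prime to that conductor.\<close>

lemma ex_quo_norm_coprime:
  assumes "int_ideal D T" "n > 0"
  obtains x where "x \<in> T" "x \<noteq> 0" "coprime (ideal_norm D (quo T x)) n"
proof -
  obtain w A where w: "A > 0" "Im w > 0" "has_CM D w" "T = sc (of_int A) (lattice w)"
    using int_ideal_CM_lattice[OF assms(1)] by metis
  obtain a b c where abc: "abc_of w a b c" using ex_abc_of_CM[OF w(2,3)] by blast
  hence a: "a > 0" and g: "gcd a (gcd b c) = 1" by (auto simp: abc_of_def)
  have "ideal_mult T (cnj ` T) = sc (of_int A * of_int A) (ideal_mult (lattice w) (cnj ` lattice w))"
    unfolding w(4) cnj_sc ideal_mult_sc ideal_mult_sc_right sc_sc by simp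
  also have "\<dots> = principal D (of_int A * of_int A * (1 / of_int a))"
    unfolding CM_lattice_norm[OF abc w(2,3)] principal_def sc_sc ..
  finally have "real (ideal_norm D T) = cmod (of_int A * of_int A * (1 / of_int a))"
    by (rule ideal_norm_eqI[OF assms(1)])
  hence nT: "real (ideal_norm D T) = of_int A * of_int A / of_int a"
    using w(1) a by (simp add: norm_mult norm_divide)
  \<comment> \<open>The middle coefficient changes sign because
    \<open>a (w + cnj w) = - b\<close>.\<close>
  have "gcd a (gcd (- b) c) = 1" using g by simp
  then obtain u v where uv: "u \<noteq> 0" "coprime (a * u\<^sup>2 + (- b) * u * v + c * v\<^sup>2) (int n)"
    using primitive_form_represents_coprime[of a "- b" c "int n"] assms(2) by auto
  define x where "x = of_int A * (of_int u + of_int v * w)"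
  have "x \<in> T" unfolding w(4) x_def lattice_def by blast
  moreover have "of_int u + of_int v * w \<noteq> 0" using int_linear_relation_trivial[of w u v] w(2) uv(1) by auto
  hence "x \<noteq> 0" using w(1) by (simp add: x_def)
  moreover have "int (ideal_norm D (quo T x)) = a * u\<^sup>2 + (- b) * u * v + c * v\<^sup>2"
  proof -
    have "complex_of_real ((cmod x)\<^sup>2) = x * cnj x" by (rule complex_norm_square)
    hence "of_int a * complex_of_real ((cmod x)\<^sup>2)
        = of_int A * of_int A * (of_int a * ((of_int u + of_int v * w) * (of_int u + of_int v * cnj w)))"
      by (simp add: x_def)
    also have "of_int a * ((of_int u + of_int v * w) * (of_int u + of_int v * cnj w))
        = of_int (a * u * u) + of_int (u * v) * (of_int a * w + of_int a * cnj w)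
          + of_int (v * v) * (of_int a * (w * cnj w))"
      by (simp add: algebra_simps)
    also have "\<dots> = of_int (a * u\<^sup>2 + (- b) * u * v + c * v\<^sup>2)"
      unfolding CM_conj_relations[OF abc w(2,3)] by (simp add: algebra_simps power2_eq_square)
    finally have "complex_of_real (of_int a * (cmod x)\<^sup>2)
        = of_real (of_int A * of_int A * of_int (a * u\<^sup>2 + (- b) * u * v + c * v\<^sup>2))" by simp
    hence "of_int a * (cmod x)\<^sup>2 = of_int A * of_int A * of_int (a * u\<^sup>2 + (- b) * u * v + c * v\<^sup>2)"
      by (simp only: of_real_eq_iff)
    moreover have "of_int a * (cmod x)\<^sup>2 = of_int A * of_int A * real (ideal_norm D (quo T x))"
      using ideal_norm_quo[OF assms(1) \<open>x \<in> T\<close> \<open>x \<noteq> 0\<close>] nT a by (simp add: field_simps)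
    ultimately have "real (ideal_norm D (quo T x)) = of_int (a * u\<^sup>2 + (- b) * u * v + c * v\<^sup>2)"
      using w(1) by simp
    thus ?thesis by linarith
  qed
  hence "coprime (int (ideal_norm D (quo T x))) (int n)" using uv(2) by simp
  hence "coprime (ideal_norm D (quo T x)) n" by simp
  ultimately show ?thesis by (rule that)
qed

section \<open>Representatives of CM elliptic curves and ideal classes\<close>

lemma CM_ideal:
  assumes "abc_of z a b c" "Im z > 0" "has_CM D z"
  shows "int_ideal D (sc (of_int a) (lattice z))" "real (ideal_norm D (sc (of_int a) (lattice z))) = of_int a"
proof -
  let ?J = "sc (of_int a) (lattice z)"
  have a: "a > 0" using assms(1) by (simp add: abc_of_def)
  have "?J \<subseteq> OK D"
  proof
    fix x assume "x \<in> ?J"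
    then obtain m n where "x = of_int a * (of_int m + of_int n * z)" by (auto simp: lattice_def)
    hence "x = of_int (a * m) + of_int n * (of_int a * z)" by (simp add: algebra_simps)
    thus "x \<in> OK D" unfolding CM_primitive_form(2)[OF assms] lattice_def by blast
  qed
  moreover have "of_int a * 1 \<in> ?J" using lattice_1 by (intro imageI)
  hence "?J \<noteq> {0}" using a by (metis mult.right_neutral of_int_eq_0_iff order_less_irrefl singletonD)
  ultimately show 1: "int_ideal D ?J" by (simp add: int_ideal_iff omod_sc omod_lattice assms)
  have "ideal_mult ?J (cnj ` ?J) = sc (of_int a * of_int a) (ideal_mult (lattice z) (cnj ` lattice z))"
    unfolding cnj_sc ideal_mult_sc ideal_mult_sc_right sc_sc by simp
  also have "\<dots> = principal D (of_int a * of_int a * (1 / of_int a))"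
    unfolding CM_lattice_norm[OF assms] principal_def sc_sc ..
  finally have "real (ideal_norm D ?J) = cmod (of_int a * of_int a * (1 / of_int a))"
    by (rule ideal_norm_eqI[OF 1])
  thus "real (ideal_norm D ?J) = of_int a" using a by (simp add: norm_mult norm_divide)
qed

text \<open>The conjugate of \<open>Q\<close> lies in the inverse class of \<open>Q\<close>, so the
  representative is chosen homothetic to it. Multiplying by \<open>Q\<close> then gives a multiple
  of \<open>Q\<close> times its conjugate, which is principal.\<close>

lemma ex_rep_principal:
  assumes "cm_reps D reps" "int_ideal D Q"
  obtains z y where "z \<in> reps" "y \<noteq> 0" "ideal_mult Q (lattice z) = principal D y"
proof -
  obtain w A where w: "A > 0" "Im w > 0" "has_CM D w" "cnj ` Q = sc (of_int A) (lattice w)"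
    using int_ideal_CM_lattice[OF int_ideal_cnj[OF assms(2)]] by metis
  have "\<exists>z\<in>reps. lattice_iso z w" using assms(1) w(2,3) by (simp add: cm_reps_def uhp_def)
  then obtain z c where z: "z \<in> reps" "c \<noteq> 0" "lattice w = sc c (lattice z)"
    unfolding lattice_iso_def by auto
  define k where "k = of_int A * c"
  have k: "k \<noteq> 0" using w z by (simp add: k_def)
  let ?n = "of_nat (ideal_norm D Q) :: complex"
  have "principal D ?n = ideal_mult Q (sc k (lattice z))"
    unfolding ideal_mult_cnj(1)[OF assms(2), symmetric] w(4) z(3) sc_sc k_def ..
  hence "principal D ?n = sc k (ideal_mult Q (lattice z))" unfolding ideal_mult_sc_right .
  hence "ideal_mult Q (lattice z) = sc (1 / k) (principal D ?n)" using sc_inverse[OF k] by metis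
  also have "\<dots> = principal D (1 / k * ?n)" unfolding principal_def sc_sc ..
  finally show ?thesis
    by (rule that[OF z(1), rotated]) (use k ideal_mult_cnj(2)[OF assms(2)] in simp)
qed

text \<open>Multiplication by the conjugate of \<open>Q\<close> shows both lattices to be homothetic
  to that conjugate, hence to each other; distinct representatives are never homothetic.\<close>

lemma rep_principal_unique:
  assumes "cm_reps D reps" "int_ideal D Q" "z \<in> reps" "z' \<in> reps" "y \<noteq> 0" "y' \<noteq> 0"
    and "ideal_mult Q (lattice z) = principal D y" "ideal_mult Q (lattice z') = principal D y'"
  shows "z = z'"
proof -
  let ?n = "of_nat (ideal_norm D Q) :: complex"
  have n: "?n \<noteq> 0" using ideal_mult_cnj(2)[OF assms(2)] by simp
  have oq: "omod (cnj ` Q)" using int_ideal_cnj[OF assms(2)] by (simp add: int_ideal_iff)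
  have *: "sc ?n (lattice x) = sc t (cnj ` Q)"
    if "x \<in> reps" "ideal_mult Q (lattice x) = principal D t" for x t
  proof -
    have ol: "omod (lattice x)" using that assms(1) by (intro omod_lattice) (auto simp: cm_reps_def)
    have "sc ?n (lattice x) = ideal_mult (ideal_mult (lattice x) Q) (cnj ` Q)"
      using ideal_mult_cnj_cancel[OF assms(2) ol] by simp
    also have "\<dots> = ideal_mult (principal D t) (cnj ` Q)" using that by (simp add: ideal_mult_commute)
    also have "\<dots> = sc t (cnj ` Q)" by (rule principal_mult[OF oq])
    finally show ?thesis .
  qed
  have "cnj ` Q = sc (1 / y) (sc ?n (lattice z))"
    using *[OF assms(3,7)] sc_inverse[OF assms(5)] by metis
  hence "sc ?n (lattice z') = sc y' (sc (1 / y) (sc ?n (lattice z)))" using *[OF assms(4,8)] by simp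
  hence "lattice z' = sc (1 / ?n) (sc y' (sc (1 / y) (sc ?n (lattice z))))" using sc_inverse[OF n] by metis
  also have "\<dots> = sc (y' / y) (lattice z)" unfolding sc_sc using n by simp
  finally have "lattice_iso z z'" unfolding lattice_iso_def using assms(5,6) by (intro exI[of _ "y' / y"]) simp
  thus ?thesis using assms(1,3,4) by (auto simp: cm_reps_def)
qed

text \<open>Choose \<open>M = l T\<close> integral and prime to \<open>cf\<close>, where \<open>T = q J\<close>. Then \<open>(y T\<^sup>-\<^sup>1) M = (l y)\<close>, so
  \<open>\<phi> (y T\<^sup>-\<^sup>1) = l y \<chi>(l y) / \<phi> M\<close>, and \<open>\<chi>(l y)\<close> depends on \<open>l y\<close> modulo \<open>cf\<close> only.\<close>

lemma hecke_coefficient_periodic: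
  assumes h: "hecke_char D cf \<phi>" and q: "int_ideal D q" and J: "int_ideal D J"
    and dvd: "ideal_dvd D (ideal_mult q cf) (cbar D f)"
  obtains \<psi> where
    "\<And>y. y \<in> ideal_mult q J \<Longrightarrow> y \<noteq> 0 \<Longrightarrow> \<phi> (quo (ideal_mult q J) y) = y * \<psi> y"
    "\<And>y. y \<notin> ideal_mult q J \<Longrightarrow> \<psi> y = 0"
    "\<And>y y'. y - y' \<in> sc (of_nat f * sqrtD D) J \<Longrightarrow> \<psi> y = \<psi> y'"
proof -
  define T where "T = ideal_mult q J"
  have T: "int_ideal D T" unfolding T_def by (rule int_ideal_mult[OF q J])
  have cf: "int_ideal D cf" and phi_nz: "\<And>I. int_ideal D I \<Longrightarrow> ideal_coprime I cf \<Longrightarrow> \<phi> I \<noteq> 0"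
    and phi_mult: "\<And>I J. int_ideal D I \<Longrightarrow> int_ideal D J \<Longrightarrow> ideal_coprime I cf \<Longrightarrow> ideal_coprime J cf
       \<Longrightarrow> \<phi> (ideal_mult I J) = \<phi> I * \<phi> J"
    and phi_0: "\<And>I. int_ideal D I \<Longrightarrow> \<not> ideal_coprime I cf \<Longrightarrow> \<phi> I = 0"
    and "has_modulus D cf cf \<phi>"
    using h by (simp_all add: hecke_char_def)
  then obtain chi where chi: "char_mod D cf chi"
    "\<And>\<alpha>. \<alpha> \<in> OK D \<Longrightarrow> ideal_coprime (principal D \<alpha>) cf \<Longrightarrow> \<phi> (principal D \<alpha>) = \<alpha> * chi \<alpha>"
    unfolding has_modulus_def by blast
  \<comment> \<open>Division is by the conjugate of \<open>T\<close>, so that the resulting ideal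
    \<open>M\<close> is a multiple of \<open>T\<close> itself and not of its conjugate.\<close>
  obtain x where x: "x \<in> cnj ` T" "x \<noteq> 0"
    "coprime (ideal_norm D (quo (cnj ` T) x)) (ideal_norm D cf)"
    using ex_quo_norm_coprime[OF int_ideal_cnj[OF T] ideal_mult_cnj(2)[OF cf]] by metis
  define M where "M = quo (cnj ` T) x"
  define l where "l = x / of_nat (ideal_norm D (cnj ` T))"
  have M: "int_ideal D M" unfolding M_def by (rule quo_props[OF int_ideal_cnj[OF T] x(1,2)])
  have Ml: "M = sc l T" unfolding M_def quo_def l_def by simp
  have Mc: "ideal_coprime M cf"
    using coprime_norms_imp_ideal_coprime[OF M cf] x(3) unfolding M_def .
  have lOK: "l * y \<in> OK D" if "y \<in> T" for y
    using that M unfolding Ml int_ideal_iff by blast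
  \<comment> \<open>Zero outside \<open>T\<close> and where \<open>l * y\<close> is not prime to
    \<open>cf\<close>, matching the extension of \<open>\<phi>\<close> by zero. The factor
    \<open>l\<close> is what remains of \<open>l * y\<close> once \<open>y\<close> is split
    off.\<close>
  define \<psi> where "\<psi> y = (if y \<in> T \<and> ideal_coprime (principal D (l * y)) cf
      then l * chi (l * y) / \<phi> M else 0)" for y
  have 1: "\<phi> (quo T y) = y * \<psi> y" if y: "y \<in> T" "y \<noteq> 0" for y
  proof -
    note Q = quo_props[OF T y]
    have QM: "ideal_mult (quo T y) M = principal D (l * y)"
      unfolding Ml ideal_mult_sc_right Q(2) principal_def sc_sc ..
    have iff: "ideal_coprime (principal D (l * y)) cf \<longleftrightarrow> ideal_coprime (quo T y) cf"
      using ideal_coprime_mult_iff[OF Q(1) M cf] Mc unfolding QM by simp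
    show ?thesis
    proof (cases "ideal_coprime (quo T y) cf")
      case True
      hence "\<phi> (quo T y) * \<phi> M = \<phi> (principal D (l * y))"
        using phi_mult[OF Q(1) M] Mc unfolding QM by simp
      also have "\<dots> = l * y * chi (l * y)" using True iff lOK[OF y(1)] by (intro chi(2)) auto
      finally show ?thesis using phi_nz[OF M Mc] True iff y(1) by (simp add: \<psi>_def field_simps)
    next
      case False
      thus ?thesis using phi_0[OF Q(1)] iff by (simp add: \<psi>_def)
    qed
  qed
  have 3: "\<psi> y = \<psi> y'" if d: "y - y' \<in> sc (of_nat f * sqrtD D) J" for y y'
  proof -
    have oJ: "omod J" and oT: "omod T" and oc: "omod cf" and cfOK: "cf \<subseteq> OK D"
      using J T cf by (auto simp: int_ideal_iff)
    obtain X where X: "int_ideal D X" "cbar D f = ideal_mult (ideal_mult q cf) X"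
      using dvd by (auto simp: ideal_dvd_def)
    \<comment> \<open>The period lattice \<open>f sqrtD J\<close> equals \<open>T cf X\<close>;
      multiplication by \<open>l\<close> carries a difference in \<open>T cf\<close> into
      \<open>M cf\<close>, hence into \<open>cf\<close>.\<close>
    have "sc (of_nat f * sqrtD D) J = ideal_mult (cbar D f) J"
      unfolding cbar_def by (rule principal_mult[OF oJ, symmetric])
    also have "\<dots> = ideal_mult (ideal_mult T cf) X"
      unfolding X(2) T_def by (metis ideal_mult_assoc ideal_mult_commute)
    also have "\<dots> \<subseteq> ideal_mult T cf"
      using ideal_mult_subset_left[OF int_ideal_mult[OF T cf], of X] X(1) by (auto simp: int_ideal_iff)
    finally have dT: "y - y' \<in> ideal_mult T cf" using d by blast
    hence dT': "y - y' \<in> T" using ideal_mult_subset_left[OF T cfOK] by blast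
    have "l * (y - y') \<in> sc l (ideal_mult T cf)" using dT by blast
    also have "sc l (ideal_mult T cf) = ideal_mult cf M" unfolding Ml by (metis ideal_mult_sc ideal_mult_commute)
    also have "\<dots> \<subseteq> cf" using ideal_mult_subset_left[OF cf] M by (simp add: int_ideal_iff)
    finally have dc: "l * y - l * y' \<in> cf" by (simp add: right_diff_distrib)
    have yy: "y \<in> T \<longleftrightarrow> y' \<in> T"
      using omodD(2)[OF oT dT', of y'] omodD(5)[OF oT _ dT', of y] by auto
    \<comment> \<open>Coprimality to \<open>cf\<close> is itself a property of the residue class, so
      the vanishing pattern of \<open>\<psi>\<close> is periodic as well.\<close>
    have cop: "ideal_coprime (principal D \<beta>) cf"
      if ab: "ideal_coprime (principal D \<alpha>) cf" "\<alpha> - \<beta> \<in> cf" for \<alpha> \<beta>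
    proof -
      obtain r s where rs: "r \<in> OK D" "s \<in> cf" "\<alpha> * r + s = 1"
        using ab(1) by (auto simp: ideal_coprime_def principal_def)
      have "r * (\<alpha> - \<beta>) + s \<in> cf" using rs ab(2) by (intro omodD(2)[OF oc] omodD(3)[OF oc])
      moreover have "\<beta> * r \<in> principal D \<beta>" using rs by (auto simp: principal_def)
      moreover have "\<beta> * r + (r * (\<alpha> - \<beta>) + s) = 1" using rs(3) by (simp add: algebra_simps)
      ultimately show ?thesis unfolding ideal_coprime_def by blast
    qed
    have "l * y' - l * y \<in> cf" using omodD(4)[OF oc dc] by simp
    hence cc: "ideal_coprime (principal D (l * y)) cf \<longleftrightarrow> ideal_coprime (principal D (l * y')) cf"
      using cop dc by blast
    have "chi (l * y) = chi (l * y')"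
      if "y \<in> T" "ideal_coprime (principal D (l * y)) cf"
      using chi(1) that lOK[of y] lOK[of y'] yy cc dc unfolding char_mod_def by blast
    thus ?thesis unfolding \<psi>_def using yy cc by auto
  qed
  show ?thesis
    by (rule that[of \<psi>]) (use 1 3 in \<open>auto simp: T_def[symmetric] \<psi>_def\<close>)
qed

definition unit_set :: "complex set" where "unit_set = {u. principal D u = OK D}"

lemma unit_set_mem: assumes "u \<in> unit_set" shows "u \<in> OK D" "cmod u = 1"
proof -
  have e: "principal D u = principal D 1" using assms by (simp add: unit_set_def principal_1)
  show "u \<in> OK D" using assms in_principal[of u] by (auto simp: unit_set_def)
  show "cmod u = 1" using principal_eq_cmod[OF e] by simp
qed

lemma one_in_unit_set: "1 \<in> unit_set" by (simp add: unit_set_def principal_1)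

lemma finite_unit_set: "finite unit_set"
proof -
  \<comment> \<open>Units have absolute value 1: \<open>B\<close> bounds the
    \<open>\<omega>\<close>-coordinate through the imaginary part, and \<open>C\<close> then bounds
    the other coordinate by the triangle inequality.\<close>
  define B where "B = \<lceil>1 / Im \<omega>\<rceil>"
  define C where "C = B * \<lceil>cmod \<omega>\<rceil> + 1"
  have "unit_set \<subseteq> (\<lambda>(m, n). of_int m + of_int n * \<omega>) ` ({-C..C} \<times> {-B..B})"
  proof
    fix u assume u: "u \<in> unit_set"
    obtain m n where mn: "u = of_int m + of_int n * \<omega>" using OK_E[OF unit_set_mem(1)[OF u]] by metis
    have "\<bar>Im u\<bar> \<le> 1" using abs_Im_le_cmod[of u] unit_set_mem(2)[OF u] by simp
    hence "of_int \<bar>n\<bar> * Im \<omega> \<le> 1" using Im_\<omega>_pos by (simp add: mn abs_mult)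
    hence "of_int \<bar>n\<bar> \<le> 1 / Im \<omega>" using Im_\<omega>_pos by (simp add: field_simps)
    hence nB: "\<bar>n\<bar> \<le> B" unfolding B_def by linarith
    have "real_of_int \<bar>m\<bar> = cmod (u - of_int n * \<omega>)" by (simp add: mn)
    also have "\<dots> \<le> 1 + of_int \<bar>n\<bar> * cmod \<omega>"
      using norm_triangle_ineq4[of u "of_int n * \<omega>"] unit_set_mem(2)[OF u] by (simp add: norm_mult)
    also have "\<dots> \<le> 1 + of_int B * of_int \<lceil>cmod \<omega>\<rceil>"
      using nB by (intro add_left_mono mult_mono) auto
    finally have "\<bar>m\<bar> \<le> C" unfolding C_def by (metis add.commute of_int_1 of_int_add of_int_le_iff of_int_mult)
    hence "(m, n) \<in> {-C..C} \<times> {-B..B}" using nB by auto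
    thus "u \<in> (\<lambda>(m, n). of_int m + of_int n * \<omega>) ` ({-C..C} \<times> {-B..B})" using mn by force
  qed
  thus ?thesis by (rule finite_subset) auto
qed

lemma principal_eq_iff:
  assumes "y \<noteq> 0" shows "principal D y' = principal D y \<longleftrightarrow> y' / y \<in> unit_set"
proof -
  have "principal D y' = sc y (principal D (y' / y))" unfolding principal_def sc_sc using assms by simp
  moreover have "principal D y = sc y (OK D)" by (simp add: principal_def)
  ultimately have "principal D y' = principal D y \<longleftrightarrow> sc y (principal D (y' / y)) = sc y (OK D)" by simp
  also have "\<dots> \<longleftrightarrow> principal D (y' / y) = OK D" using sc_cancel[OF assms] by metis
  finally show ?thesis by (simp add: unit_set_def)
qed

end

section \<open>Theta series of lattice cosets\<close>

lemma summable_on_int_geometric: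
  fixes r :: real
  assumes "0 \<le> r" "r < 1"
  shows "(\<lambda>m::int. r ^ nat \<bar>m\<bar>) summable_on UNIV"
proof -
  have nat: "(\<lambda>n::nat. r ^ n) summable_on UNIV"
    using assms summable_geometric[of r] by (subst summable_on_UNIV_nonneg_real_iff) auto
  have "(\<lambda>m::int. r ^ nat \<bar>m\<bar>) summable_on (range int)"
    by (subst summable_on_reindex) (use nat in \<open>auto simp: o_def\<close>)
  moreover have "(\<lambda>m::int. r ^ nat \<bar>m\<bar>) summable_on (range (\<lambda>n. - int n))"
    by (subst summable_on_reindex) (use nat in \<open>auto simp: o_def inj_on_def\<close>)
  ultimately have "(\<lambda>m::int. r ^ nat \<bar>m\<bar>) summable_on (range int \<union> range (\<lambda>n. - int n))"
    by (rule summable_on_union)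
  also have "range int \<union> range (\<lambda>n. - int n) = UNIV"
  proof -
    have "m \<in> range int \<union> range (\<lambda>n. - int n)" for m
      by (cases m rule: int_cases2) auto
    thus ?thesis by blast
  qed
  finally show ?thesis .
qed

lemma summable_on_int_pair_geometric:
  fixes r :: real
  assumes "0 \<le> r" "r < 1"
  shows "(\<lambda>(m::int, n::int). r ^ nat \<bar>m\<bar> * r ^ nat \<bar>n\<bar>) summable_on UNIV"
proof -
  note S = summable_on_int_geometric[OF assms]
  have "(\<lambda>(m::int, n::int). r ^ nat \<bar>m\<bar> * r ^ nat \<bar>n\<bar>) summable_on Sigma UNIV (\<lambda>_. UNIV)"
  proof (rule summable_on_SigmaI)
    fix m :: int
    show "((\<lambda>n. case (m, n) of (m, n) \<Rightarrow> r ^ nat \<bar>m\<bar> * r ^ nat \<bar>n\<bar>) has_sum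
        (r ^ nat \<bar>m\<bar> * infsum (\<lambda>n::int. r ^ nat \<bar>n\<bar>) UNIV)) UNIV"
      using has_sum_cmult_right[OF has_sum_infsum[OF S]] by simp
  next
    show "(\<lambda>m::int. r ^ nat \<bar>m\<bar> * infsum (\<lambda>n::int. r ^ nat \<bar>n\<bar>) UNIV) summable_on UNIV"
      by (rule summable_on_cmult_left[OF S])
  qed (use assms in auto)
  thus ?thesis by simp
qed

lemma lattice_coords_le_cmod:
  assumes "Im z > 0"
  obtains K where "K > 0" "\<And>m n. real_of_int (\<bar>m\<bar> + \<bar>n\<bar>) \<le> K * cmod (of_int m + of_int n * z)"
proof
  \<comment> \<open>With \<open>s\<close> the absolute value, the constant collects
    \<open>|n| \<le> s / Im z\<close> and \<open>|m| \<le> s + |n| |z|\<close>.\<close>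
  show "1 + (cmod z + 1) / Im z > 0" using assms by (intro add_pos_nonneg) auto
  fix m n :: int
  let ?s = "cmod (of_int m + of_int n * z)"
  have "real_of_int \<bar>n\<bar> * Im z \<le> ?s"
    using abs_Im_le_cmod[of "of_int m + of_int n * z"] assms by (simp add: abs_mult)
  hence n: "real_of_int \<bar>n\<bar> \<le> ?s / Im z" using assms by (simp add: field_simps)
  have "real_of_int \<bar>m\<bar> = cmod ((of_int m + of_int n * z) - of_int n * z)" by simp
  also have "\<dots> \<le> ?s + real_of_int \<bar>n\<bar> * cmod z"
    using norm_triangle_ineq4[of "of_int m + of_int n * z" "of_int n * z"] by (simp add: norm_mult)
  also have "\<dots> \<le> ?s + ?s / Im z * cmod z" using n by (intro add_left_mono mult_right_mono) auto
  finally have "real_of_int (\<bar>m\<bar> + \<bar>n\<bar>) \<le> ?s + ?s / Im z * cmod z + ?s / Im z" using n by simp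
  also have "\<dots> = (1 + (cmod z + 1) / Im z) * ?s" using assms by (simp add: field_simps)
  finally show "real_of_int (\<bar>m\<bar> + \<bar>n\<bar>) \<le> (1 + (cmod z + 1) / Im z) * ?s" .
qed

text \<open>Half of the Gaussian decay absorbs the linear factor: \<open>s \<le> 1 + s^2\<close>,
  and \<open>1 + s^2\<close> is at most a constant times \<open>1 + \<kappa> / 2 * s^2\<close>,
  hence times \<open>exp (\<kappa> / 2 * s^2)\<close>.\<close>

lemma linear_times_gaussian_bound:
  fixes s \<kappa> :: real
  assumes "\<kappa> > 0"
  shows "s * exp (- \<kappa> * s\<^sup>2) \<le> (1 + 2 / \<kappa>) * exp (- (\<kappa> / 2) * s\<^sup>2)"
proof -
  have "s \<le> 1 + s\<^sup>2" using zero_le_power2[of "s - 1/2"] by (simp add: power2_eq_square algebra_simps)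
  also have "\<dots> \<le> (1 + 2 / \<kappa>) * (1 + \<kappa> / 2 * s\<^sup>2)" using assms by (simp add: field_simps)
  also have "\<dots> \<le> (1 + 2 / \<kappa>) * exp (\<kappa> / 2 * s\<^sup>2)"
    using assms exp_ge_add_one_self[of "\<kappa> / 2 * s\<^sup>2"] by (intro mult_left_mono) auto
  finally have "s * exp (- \<kappa> * s\<^sup>2) \<le> (1 + 2 / \<kappa>) * exp (\<kappa> / 2 * s\<^sup>2) * exp (- \<kappa> * s\<^sup>2)"
    by (rule mult_right_mono) simp
  also have "\<dots> = (1 + 2 / \<kappa>) * exp (- (\<kappa> / 2) * s\<^sup>2)"
    by (simp add: mult.assoc flip: exp_add)
  finally show ?thesis .
qed

lemma lattice_image: "lattice z = range (\<lambda>(m, n). of_int m + of_int n * z)"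
  by (auto simp: lattice_def image_def)

lemma inj_lattice_coords: "Im z \<noteq> 0 \<Longrightarrow> inj (\<lambda>(m, n). of_int m + of_int n * z)"
  by (rule injI) (auto dest!: lattice_coords_unique)

lemma gaussian_summable_on_lattice:
  assumes "Im z > 0" "\<kappa> > 0"
  shows "(\<lambda>X. cmod X * exp (- \<kappa> * (cmod X)\<^sup>2)) summable_on lattice z"
proof -
  obtain K where K: "K > 0" "\<And>m n. real_of_int (\<bar>m\<bar> + \<bar>n\<bar>) \<le> K * cmod (of_int m + of_int n * z)"
    using lattice_coords_le_cmod[OF assms(1)] by metis
  \<comment> \<open>Chosen so that \<open>exp (- (\<kappa> / 2) * s^2) \<le> r ^ t\<close> for
    \<open>t = |m| + |n|\<close>: the bounds \<open>t \<le> K s\<close> and, for natural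
    \<open>t\<close>, \<open>t \<le> t^2\<close> trade the square for a linear exponent.\<close>
  define r where "r = exp (- (\<kappa> / 2) / K\<^sup>2)"
  have r: "0 \<le> r" "r < 1" using assms K by (auto simp: r_def)
  let ?C = "1 + 2 / \<kappa>"
  have "(\<lambda>(m, n). cmod (of_int m + of_int n * z) * exp (- \<kappa> * (cmod (of_int m + of_int n * z))\<^sup>2))
      summable_on UNIV"
  proof (rule summable_on_comparison_test)
    show "(\<lambda>p. ?C * (case p of (m::int, n::int) \<Rightarrow> r ^ nat \<bar>m\<bar> * r ^ nat \<bar>n\<bar>)) summable_on UNIV"
      by (rule summable_on_cmult_right[OF summable_on_int_pair_geometric[OF r]])
  next
    fix p :: "int \<times> int"
    obtain m n where p: "p = (m, n)" by (cases p)
    let ?s = "cmod (of_int m + of_int n * z)"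
    define t where "t = nat \<bar>m\<bar> + nat \<bar>n\<bar>"
    have t: "real t \<le> K * ?s" using K(2)[of m n] by (simp add: t_def)
    have "real t \<le> (real t)\<^sup>2" by (cases t) (auto simp: power2_eq_square)
    also have "\<dots> \<le> (K * ?s)\<^sup>2" using t by (intro power_mono) auto
    finally have "real t / K\<^sup>2 \<le> ?s\<^sup>2" using K(1) by (simp add: power_mult_distrib field_simps)
    hence "\<kappa> / 2 * (real t / K\<^sup>2) \<le> \<kappa> / 2 * ?s\<^sup>2" using assms(2) by (intro mult_left_mono) auto
    hence "exp (- (\<kappa> / 2) * ?s\<^sup>2) \<le> exp (real t * (- (\<kappa> / 2) / K\<^sup>2))"
      by (simp add: mult.commute)
    also have "\<dots> = r ^ t" unfolding r_def by (rule exp_of_nat_mult)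
    also have "\<dots> = r ^ nat \<bar>m\<bar> * r ^ nat \<bar>n\<bar>" by (simp add: t_def power_add)
    finally have "?C * exp (- (\<kappa> / 2) * ?s\<^sup>2) \<le> ?C * (r ^ nat \<bar>m\<bar> * r ^ nat \<bar>n\<bar>)"
      using assms(2) by (intro mult_left_mono) auto
    hence "?s * exp (- \<kappa> * ?s\<^sup>2) \<le> ?C * (r ^ nat \<bar>m\<bar> * r ^ nat \<bar>n\<bar>)"
      using linear_times_gaussian_bound[OF assms(2), of ?s] by linarith
    thus "(case p of (m, n) \<Rightarrow> cmod (of_int m + of_int n * z) * exp (- \<kappa> * (cmod (of_int m + of_int n * z))\<^sup>2))
        \<le> ?C * (case p of (m, n) \<Rightarrow> r ^ nat \<bar>m\<bar> * r ^ nat \<bar>n\<bar>)" by (simp add: p)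
  qed auto
  thus ?thesis unfolding lattice_image
    by (subst summable_on_reindex)
       (use assms inj_lattice_coords[of z] in \<open>auto simp: o_def case_prod_unfold\<close>)
qed

text \<open>As \<open>1 / a\<close> is the norm of \<open>L = \<int> + \<int> z\<close>, the
  quantity \<open>a |X|^2\<close> is the norm of the ideal \<open>X L^-1\<close>: this is the
  summand of a theta series over an ideal class, before any periodic weight.\<close>

definition theta_term :: "int \<Rightarrow> complex \<Rightarrow> complex \<Rightarrow> complex" where
  "theta_term a \<tau> X = X * exp (2 * of_real pi * \<i> * \<tau> * of_real (of_int a * (cmod X)\<^sup>2))"

lemma theta_term_summable:
  assumes "Im z > 0" "Im \<tau> > 0" "a > 0"
  shows "theta_term a \<tau> summable_on lattice z"
proof -
  define \<kappa> where "\<kappa> = 2 * pi * Im \<tau> * of_int a"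
  have "\<kappa> > 0" using assms by (simp add: \<kappa>_def)
  have "cmod (theta_term a \<tau> X) = cmod X * exp (- \<kappa> * (cmod X)\<^sup>2)" for X
    by (simp add: theta_term_def norm_mult norm_exp_eq_Re \<kappa>_def algebra_simps)
  hence "(\<lambda>X. cmod (theta_term a \<tau> X)) summable_on lattice z"
    using gaussian_summable_on_lattice[OF assms(1) \<open>\<kappa> > 0\<close>] by simp
  thus ?thesis by (rule abs_summable_summable)
qed

lemma of_int_divide_Ints_iff:
  assumes "y \<noteq> 0" shows "(of_int x / of_int y :: rat) \<in> \<int> \<longleftrightarrow> y dvd x"
proof
  assume "(of_int x / of_int y :: rat) \<in> \<int>"
  then obtain k where "(of_int x / of_int y :: rat) = of_int k" by (auto elim: Ints_cases)
  hence "(of_int x :: rat) = of_int (y * k)" using assms by (simp add: field_simps)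
  thus "y dvd x" by (simp only: of_int_eq_iff) simp
next
  assume "y dvd x"
  then obtain k where "x = y * k" by (rule dvdE)
  thus "(of_int x / of_int y :: rat) \<in> \<int>" using assms by simp
qed

text \<open>The span is phrased with a finite set of functions, so indices that give the same
  function must have their coefficients added up.\<close>

lemma inF_linear_combination:
  assumes "finite A" "\<And>i. i \<in> A \<Longrightarrow> g i \<in> genF D f reps"
    and "\<And>\<tau>. \<tau> \<in> uhp \<Longrightarrow> h \<tau> = (\<Sum>i\<in>A. k i * g i \<tau>)"
  shows "inF D f reps h"
  unfolding inF_def
proof (intro exI conjI ballI)
  show "finite (g ` A)" "g ` A \<subseteq> genF D f reps" using assms(1,2) by auto
  fix \<tau> assume "\<tau> \<in> uhp"
  hence "h \<tau> = (\<Sum>i\<in>A. k i * g i \<tau>)" by (rule assms(3))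
  also have "\<dots> = (\<Sum>y\<in>g ` A. \<Sum>i\<in>{i\<in>A. g i = y}. k i * g i \<tau>)" by (rule sum.image_gen[OF assms(1)])
  also have "\<dots> = (\<Sum>y\<in>g ` A. (\<Sum>i\<in>{i\<in>A. g i = y}. k i) * y \<tau>)"
    by (intro sum.cong refl) (auto simp: sum_distrib_right)
  finally show "h \<tau> = (\<Sum>y\<in>g ` A. (\<Sum>i\<in>{i\<in>A. g i = y}. k i) * y \<tau>)" .
qed

section \<open>The dual lattice in complex coordinates\<close>

context imag_quad
begin

text \<open>With \<open>y = (i e\<^sub>2 + j e\<^sub>1) / (f |D|)\<close>, the complex number \<open>dual_pt z i j\<close> is \<open>f \<surd>D\<close> times the
  unnormalised \<open>\<Omega>'(y)\<close>; the dual lattice becomes \<open>\<int> + \<int>z\<close> and \<open>\<Lambda>\<close> becomes \<open>f \<surd>D (\<int> + \<int>z)\<close>.\<close>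

definition dual_pt :: "complex \<Rightarrow> int \<Rightarrow> int \<Rightarrow> complex" where
  "dual_pt z i j = sqrtD D * (of_int i - of_int j * z) / of_int \<bar>D\<bar>"

context
  fixes z :: complex and a b c :: int
  assumes abc: "abc_of z a b c" and Imz: "Im z > 0" and CM: "has_CM D z"
begin

lemma a_pos: "a > 0" using abc by (simp add: abc_of_def)

lemma CM_disc: "b * b - 4 * a * c = D"
proof -
  have "of_int (b * b - 4 * a * c) = (2 * of_int a * z + of_int b) * (2 * of_int a * z + of_int b)
      - 4 * of_int a * (of_int a * z\<^sup>2 + of_int b * z + of_int c)"
    by (simp add: algebra_simps power2_eq_square)
  also have "\<dots> = of_int D"
    using abc CM_primitive_form(1)[OF abc Imz CM] sqrtD_sq by (simp add: abc_of_def)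
  finally show ?thesis by (simp only: of_int_eq_iff)
qed

text \<open>The coordinates on the right are the Gram matrix, without its factor \<open>f\<close>,
  applied to \<open>(i, j)\<close>. Pairing with the basis of \<open>\<Lambda>\<close> thus becomes
  reading off coordinates in \<open>1, z\<close>, which is why duality turns into membership in
  \<open>lattice z\<close>.\<close>

lemma sqrtD_times_dual:
  "sqrtD D * (of_int i - of_int j * z) = of_int (b * i + 2 * c * j) + of_int (2 * a * i + b * j) * z"
proof -
  have "sqrtD D * (of_int i - of_int j * z)
      = of_int (b * i) + of_int (2 * a * i - b * j) * z - 2 * of_int j * (of_int a * z\<^sup>2)"
    unfolding CM_primitive_form(1)[OF abc Imz CM, symmetric]
    by (simp add: algebra_simps power2_eq_square)
  also have "of_int a * z\<^sup>2 = - of_int b * z - of_int c"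
    using abc by (simp add: abc_of_def algebra_simps eq_neg_iff_add_eq_0)
  finally show ?thesis by (simp add: algebra_simps)
qed

lemma dual_pt_lattice_iff:
  "dual_pt z i j \<in> lattice z \<longleftrightarrow> D dvd 2 * a * i + b * j \<and> D dvd b * i + 2 * c * j"
proof
  assume "dual_pt z i j \<in> lattice z"
  then obtain m n where "dual_pt z i j = of_int m + of_int n * z" by (rule latticeE)
  hence "sqrtD D * (of_int i - of_int j * z) = of_int (\<bar>D\<bar> * m) + of_int (\<bar>D\<bar> * n) * z"
    using D_neg by (simp add: dual_pt_def field_simps)
  hence "b * i + 2 * c * j = \<bar>D\<bar> * m \<and> 2 * a * i + b * j = \<bar>D\<bar> * n"
    unfolding sqrtD_times_dual using Imz by (intro lattice_coords_unique[of z]) auto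
  thus "D dvd 2 * a * i + b * j \<and> D dvd b * i + 2 * c * j" by simp
next
  assume "D dvd 2 * a * i + b * j \<and> D dvd b * i + 2 * c * j"
  hence "\<bar>D\<bar> dvd 2 * a * i + b * j" "\<bar>D\<bar> dvd b * i + 2 * c * j" by auto
  then obtain n m where mn: "2 * a * i + b * j = \<bar>D\<bar> * n" "b * i + 2 * c * j = \<bar>D\<bar> * m" by (meson dvdE)
  have "dual_pt z i j = of_int m + of_int n * z"
    unfolding dual_pt_def sqrtD_times_dual mn using D_neg by (simp add: field_simps)
  thus "dual_pt z i j \<in> lattice z" unfolding lattice_def by blast
qed

text \<open>The witnesses come from the adjugate of the matrix with rows \<open>(2 a, b)\<close> and
  \<open>(b, 2 c)\<close>, whose determinant is \<open>|D|\<close>.\<close>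

lemma dual_pt_surj: "of_int m + of_int n * z = dual_pt z (2 * c * n - b * m) (2 * a * m - b * n)"
proof -
  have "b * (2 * c * n - b * m) + 2 * c * (2 * a * m - b * n) = - (b * b - 4 * a * c) * m"
    "2 * a * (2 * c * n - b * m) + b * (2 * a * m - b * n) = - (b * b - 4 * a * c) * n"
    by (simp_all add: algebra_simps)
  hence *: "b * (2 * c * n - b * m) + 2 * c * (2 * a * m - b * n) = \<bar>D\<bar> * m"
    "2 * a * (2 * c * n - b * m) + b * (2 * a * m - b * n) = \<bar>D\<bar> * n"
    unfolding CM_disc using D_neg by simp_all
  show ?thesis unfolding dual_pt_def sqrtD_times_dual * using D_neg by (simp add: field_simps)
qed

lemma dual_pt_inj: "dual_pt z i j = dual_pt z i' j' \<Longrightarrow> i = i' \<and> j = j'"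
proof -
  assume "dual_pt z i j = dual_pt z i' j'"
  hence "of_int i + of_int (- j) * z = of_int i' + of_int (- j') * z"
    using D_neg by (simp add: dual_pt_def)
  hence "i = i' \<and> - j = - j'" using Imz by (intro lattice_coords_unique[of z]) auto
  thus ?thesis by simp
qed

context
  fixes f :: nat
  assumes f_pos: "f > 0"
begin

text \<open>The form \<open>(a, b, c)\<close> has Gram determinant \<open>|D|\<close>, so
  \<open>f |D|\<close> is a common denominator for the coordinates of all dual vectors, and
  translation by \<open>\<Lambda>\<close> becomes a shift of \<open>i\<close> and \<open>j\<close>
  by multiples of it.\<close>

definition dual_denom :: int where "dual_denom = int f * \<bar>D\<bar>"

text \<open>Representatives of the discriminant group of \<open>\<Lambda>\<close>: dual vectors
  whose coordinates \<open>i / (f |D|)\<close> and \<open>j / (f |D|)\<close> lie in the half-open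
  unit interval.\<close>

definition dual_reps :: "(int \<times> int) set" where
  "dual_reps = {(i, j). 0 \<le> i \<and> i < dual_denom \<and> 0 \<le> j \<and> j < dual_denom \<and> dual_pt z i j \<in> lattice z}"

lemma dual_denom_pos: "dual_denom > 0"
  unfolding dual_denom_def using f_pos D_neg by (intro mult_pos_pos) auto

lemma finite_dual_reps: "finite dual_reps"
  by (rule finite_subset[of _ "{0..<dual_denom} \<times> {0..<dual_denom}"]) (auto simp: dual_reps_def)

lemma in_dual_iff:
  "in_dual f a b c (of_int i / of_int dual_denom) (of_int j / of_int dual_denom) \<longleftrightarrow> dual_pt z i j \<in> lattice z"
proof -
  have "of_nat f * (2 * of_int a * (of_int i / of_int dual_denom) + of_int b * (of_int j / of_int dual_denom))
      = (of_int (2 * a * i + b * j) / of_int \<bar>D\<bar> :: rat)"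
    "of_nat f * (of_int b * (of_int i / of_int dual_denom) + 2 * of_int c * (of_int j / of_int dual_denom))
      = (of_int (b * i + 2 * c * j) / of_int \<bar>D\<bar> :: rat)"
    using f_pos D_neg by (simp_all add: dual_denom_def field_simps)
  moreover have "\<bar>D\<bar> \<noteq> 0" using D_neg by simp
  ultimately show ?thesis
    unfolding in_dual_def dual_pt_lattice_iff
    by (simp only: of_int_divide_Ints_iff not_False_eq_True abs_dvd_iff)
qed

lemma dual_pt_shift:
  "dual_pt z (i + dual_denom * m) (j + dual_denom * n) = dual_pt z i j + of_nat f * sqrtD D * (of_int m - of_int n * z)"
proof -
  have "of_int dual_denom = of_nat f * (of_int \<bar>D\<bar> :: complex)" by (simp add: dual_denom_def)
  thus ?thesis using D_neg by (simp add: dual_pt_def field_simps)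
qed

lemma dual_pt_shift_lattice:
  "dual_pt z (i + dual_denom * m) (j + dual_denom * n) \<in> lattice z \<longleftrightarrow> dual_pt z i j \<in> lattice z"
proof -
  have "D dvd dual_denom" by (simp add: dual_denom_def)
  hence "D dvd 2 * a * (dual_denom * m) + b * (dual_denom * n)" "D dvd b * (dual_denom * m) + 2 * c * (dual_denom * n)" by auto
  moreover have "2 * a * (i + dual_denom * m) + b * (j + dual_denom * n) = 2 * a * i + b * j + (2 * a * (dual_denom * m) + b * (dual_denom * n))"
    "b * (i + dual_denom * m) + 2 * c * (j + dual_denom * n) = b * i + 2 * c * j + (b * (dual_denom * m) + 2 * c * (dual_denom * n))"
    by (simp_all add: algebra_simps)
  ultimately show ?thesis unfolding dual_pt_lattice_iff by (metis dvd_add_left_iff)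
qed

definition coset :: "int \<times> int \<Rightarrow> complex set" where
  "coset = (\<lambda>(i, j). range (\<lambda>(m, n). dual_pt z (i + dual_denom * m) (j + dual_denom * n)))"

lemma lattice_cosets: "lattice z = (\<Union>r\<in>dual_reps. coset r)"
proof (intro equalityI subsetI)
  fix x assume "x \<in> lattice z"
  then obtain m n where "x = of_int m + of_int n * z" by (rule latticeE)
  then obtain i j where x: "x = dual_pt z i j" using dual_pt_surj by metis
  have ij: "i = i mod dual_denom + dual_denom * (i div dual_denom)" "j = j mod dual_denom + dual_denom * (j div dual_denom)" by simp_all
  hence x2: "x = dual_pt z (i mod dual_denom + dual_denom * (i div dual_denom)) (j mod dual_denom + dual_denom * (j div dual_denom))" using x by simp
  hence "dual_pt z (i mod dual_denom) (j mod dual_denom) \<in> lattice z"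
    using \<open>x \<in> lattice z\<close> dual_pt_shift_lattice by metis
  hence "(i mod dual_denom, j mod dual_denom) \<in> dual_reps" using dual_denom_pos by (simp add: dual_reps_def)
  moreover have "x \<in> coset (i mod dual_denom, j mod dual_denom)"
    unfolding coset_def prod.case by (rule range_eqI[of _ _ "(i div dual_denom, j div dual_denom)"]) (use x2 in simp)
  ultimately show "x \<in> (\<Union>r\<in>dual_reps. coset r)" by blast
next
  fix x assume "x \<in> (\<Union>r\<in>dual_reps. coset r)"
  thus "x \<in> lattice z" by (auto simp: coset_def dual_reps_def dual_pt_shift_lattice)
qed

lemma cosets_disjoint:
  assumes "r \<in> dual_reps" "r' \<in> dual_reps" "r \<noteq> r'"
  shows "coset r \<inter> coset r' = {}"
proof (rule ccontr)
  assume "coset r \<inter> coset r' \<noteq> {}"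
  then obtain x where "x \<in> coset r" "x \<in> coset r'" by blast
  then obtain m n m' n' where e: "dual_pt z (fst r + dual_denom * m) (snd r + dual_denom * n) = dual_pt z (fst r' + dual_denom * m') (snd r' + dual_denom * n')"
    by (auto simp: coset_def case_prod_unfold)
  hence "fst r + dual_denom * m = fst r' + dual_denom * m'" "snd r + dual_denom * n = snd r' + dual_denom * n'"
    using dual_pt_inj by blast+
  hence "(fst r + dual_denom * m) mod dual_denom = (fst r' + dual_denom * m') mod dual_denom" "(snd r + dual_denom * n) mod dual_denom = (snd r' + dual_denom * n') mod dual_denom"
    by simp_all
  hence "fst r = fst r'" "snd r = snd r'" using assms by (auto simp: dual_reps_def)
  thus False using assms(3) by (simp add: prod_eq_iff)
qed

text \<open>The constant ratio of \<open>Omega'\<close> to \<open>dual_pt\<close> at the same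
  vector.\<close>

definition Omega_scale :: complex where
  "Omega_scale = of_real (sqrt (2 * of_int a * real f)) / (of_nat f * sqrtD D)"

lemma Omega_scale_nz: "Omega_scale \<noteq> 0"
  using f_pos a_pos by (simp add: Omega_scale_def)

text \<open>With \<open>w = u - v z\<close>, \<open>qform\<close> is \<open>2 f a |w|^2\<close> and
  the square of the absolute value of \<open>X = dual_pt z i j\<close> is
  \<open>f^2 |D| |w|^2\<close>. The factor \<open>f |D|\<close> in the exponent of \<open>fa\<close>
  is therefore exactly what turns the quadratic form into \<open>2 a |X|^2\<close>.\<close>

lemma fa_summand:
  assumes u: "u = real_of_int i / of_int dual_denom" and v: "v = real_of_int j / of_int dual_denom"
  shows "Omega' f z a u v * exp (of_real pi * \<i> * of_nat f * of_int \<bar>D\<bar> * \<tau> * of_real (qform f a b c u v))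
    = Omega_scale * theta_term a \<tau> (dual_pt z i j)"
proof -
  let ?w = "complex_of_real u - of_real v * z"
  have Nc: "(of_int dual_denom :: complex) = of_nat f * of_int \<bar>D\<bar>" by (simp add: dual_denom_def)
  have w: "?w = (of_int i - of_int j * z) / of_int dual_denom" unfolding u v by (simp add: diff_divide_distrib)
  have X: "dual_pt z i j = of_nat f * sqrtD D * ?w"
    unfolding w Nc dual_pt_def using f_pos by simp
  have 1: "Omega' f z a u v = Omega_scale * dual_pt z i j"
    unfolding Omega'_def Omega_scale_def X using f_pos by simp
  have cm: "(cmod (sqrtD D))\<^sup>2 = of_int \<bar>D\<bar>"
    using D_neg by (simp add: sqrtD_def norm_mult)
  have w2: "of_int a * (cmod ?w)\<^sup>2 = of_int a * u\<^sup>2 + of_int b * u * v + of_int c * v\<^sup>2"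
  proof -
    have "complex_of_real (of_int a * (cmod ?w)\<^sup>2) = of_int a * (?w * cnj ?w)"
      by (simp only: of_real_mult complex_norm_square) simp
    also have "\<dots> = of_int a * of_real u * of_real u - of_real u * of_real v * (of_int a * z + of_int a * cnj z)
        + of_real v * of_real v * (of_int a * (z * cnj z))"
      by (simp add: algebra_simps)
    also have "\<dots> = of_real (of_int a * u\<^sup>2 + of_int b * u * v + of_int c * v\<^sup>2)"
      unfolding CM_conj_relations[OF abc Imz CM] by (simp add: algebra_simps power2_eq_square)
    finally show ?thesis by (simp only: of_real_eq_iff)
  qed
  have "of_int a * (cmod (dual_pt z i j))\<^sup>2 = (real f)\<^sup>2 * (cmod (sqrtD D))\<^sup>2 * (of_int a * (cmod ?w)\<^sup>2)"
    unfolding X by (simp add: norm_mult power_mult_distrib)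
  hence "2 * (of_int a * (cmod (dual_pt z i j))\<^sup>2) = real f * of_int \<bar>D\<bar> * qform f a b c u v"
    unfolding cm w2 qform_def by (simp add: power2_eq_square algebra_simps)
  hence "complex_of_real (2 * (of_int a * (cmod (dual_pt z i j))\<^sup>2)) = of_real (real f * of_int \<bar>D\<bar> * qform f a b c u v)"
    by (simp only: of_real_eq_iff)
  moreover have "complex_of_real (of_int \<bar>D\<bar>) = of_int \<bar>D\<bar>" by (rule of_real_of_int_eq)
  ultimately have "of_nat f * of_int \<bar>D\<bar> * of_real (qform f a b c u v) = 2 * complex_of_real (of_int a * (cmod (dual_pt z i j))\<^sup>2)"
    by (simp only: of_real_mult of_real_of_nat_eq of_real_numeral)
  hence "of_real pi * \<i> * \<tau> * (of_nat f * of_int \<bar>D\<bar> * of_real (qform f a b c u v))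
      = of_real pi * \<i> * \<tau> * (2 * complex_of_real (of_int a * (cmod (dual_pt z i j))\<^sup>2))"
    by (rule arg_cong)
  hence 2: "of_real pi * \<i> * of_nat f * of_int \<bar>D\<bar> * \<tau> * of_real (qform f a b c u v)
      = 2 * of_real pi * \<i> * \<tau> * complex_of_real (of_int a * (cmod (dual_pt z i j))\<^sup>2)"
    by (simp only: mult_ac)
  show ?thesis unfolding 1 2 theta_term_def by simp
qed

text \<open>Summability is inherited from the whole lattice, so the infinite sum in
  \<open>fa\<close> is attained and can be recombined with those of the other cosets.\<close>

lemma fa_has_sum:
  assumes "Im \<tau> > 0" "(i, j) \<in> dual_reps"
  shows "(theta_term a \<tau> has_sum (fa D f z a b c (of_int i / of_int dual_denom) (of_int j / of_int dual_denom) \<tau> / Omega_scale)) (coset (i, j))"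
proof -
  define g where "g = (\<lambda>(m, n). dual_pt z (i + dual_denom * m) (j + dual_denom * n))"
  have "inj g"
  proof (rule injI)
    fix p q assume "g p = g q"
    hence "i + dual_denom * fst p = i + dual_denom * fst q \<and> j + dual_denom * snd p = j + dual_denom * snd q"
      unfolding g_def case_prod_unfold by (intro dual_pt_inj) auto
    thus "p = q" using dual_denom_pos by (auto simp: prod_eq_iff)
  qed
  have cg: "coset (i, j) = range g" by (simp add: coset_def g_def)
  have "coset (i, j) \<subseteq> lattice z" using lattice_cosets assms(2) by blast
  hence "theta_term a \<tau> summable_on coset (i, j)"
    using theta_term_summable[OF Imz assms(1) a_pos] summable_on_subset by blast
  hence hs: "(theta_term a \<tau> has_sum infsum (theta_term a \<tau>) (coset (i, j))) (coset (i, j))" by (rule has_sum_infsum)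
  hence "((\<lambda>p. theta_term a \<tau> (g p)) has_sum infsum (theta_term a \<tau>) (coset (i, j))) UNIV"
    using has_sum_reindex[OF \<open>inj g\<close>, of "theta_term a \<tau>"] unfolding cg by (simp add: o_def)
  hence "((\<lambda>p. Omega_scale * theta_term a \<tau> (g p)) has_sum (Omega_scale * infsum (theta_term a \<tau>) (coset (i, j)))) UNIV"
    by (rule has_sum_cmult_right)
  moreover have "Omega_scale * theta_term a \<tau> (g (m, n)) =
     Omega' f z a (of_rat (of_int i / of_int dual_denom) + of_int m) (of_rat (of_int j / of_int dual_denom) + of_int n) *
     exp (of_real pi * \<i> * of_nat f * of_int \<bar>D\<bar> * \<tau> *
          of_real (qform f a b c (of_rat (of_int i / of_int dual_denom) + of_int m) (of_rat (of_int j / of_int dual_denom) + of_int n)))"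
    for m n
  proof -
    have "of_rat (of_int i / of_int dual_denom) + of_int m = real_of_int (i + dual_denom * m) / of_int dual_denom" for i m
      using dual_denom_pos by (simp add: of_rat_divide field_simps)
    thus ?thesis unfolding g_def prod.case by (intro fa_summand[symmetric])
  qed
  ultimately have "fa D f z a b c (of_int i / of_int dual_denom) (of_int j / of_int dual_denom) \<tau> = Omega_scale * infsum (theta_term a \<tau>) (coset (i, j))"
    unfolding fa_def by (intro infsumI) (auto simp: case_prod_unfold elim!: has_sum_cong[THEN iffD1, rotated])
  hence "infsum (theta_term a \<tau>) (coset (i, j)) = fa D f z a b c (of_int i / of_int dual_denom) (of_int j / of_int dual_denom) \<tau> / Omega_scale"
    using Omega_scale_nz by simp
  thus ?thesis using hs by simp
qed

text \<open>A periodic weight is constant on each of the finitely many cosets and comes out of the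
  sum. The argument is \<open>a X\<close> because the weight will be that of the integral ideal
  \<open>a (\<int> + \<int> z)\<close>.\<close>

lemma periodic_theta_has_sum:
  assumes per: "\<And>y y'. y - y' \<in> sc (of_nat f * sqrtD D) (sc (of_int a) (lattice z)) \<Longrightarrow> \<psi> y = \<psi> y'"
    and "Im \<tau> > 0"
  shows "((\<lambda>X. \<psi> (of_int a * X) * theta_term a \<tau> X) has_sum
     (\<Sum>(i, j)\<in>dual_reps. \<psi> (of_int a * dual_pt z i j) *
        (fa D f z a b c (of_int i / of_int dual_denom) (of_int j / of_int dual_denom) \<tau> / Omega_scale))) (lattice z)"
  unfolding lattice_cosets
proof (rule sum_has_sum[OF finite_dual_reps])
  fix r assume r: "r \<in> dual_reps"
  obtain i j where ij: "r = (i, j)" by (cases r)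
  have const: "\<psi> (of_int a * X) = \<psi> (of_int a * dual_pt z i j)" if X: "X \<in> coset (i, j)" for X
  proof (rule per)
    obtain m n where "X = dual_pt z (i + dual_denom * m) (j + dual_denom * n)" using X by (auto simp: coset_def)
    hence "of_int a * X - of_int a * dual_pt z i j = of_nat f * sqrtD D * (of_int a * (of_int m + of_int (- n) * z))"
      by (simp only: dual_pt_shift) (simp add: algebra_simps)
    thus "of_int a * X - of_int a * dual_pt z i j \<in> sc (of_nat f * sqrtD D) (sc (of_int a) (lattice z))"
      unfolding lattice_def by blast
  qed
  have "((\<lambda>X. \<psi> (of_int a * dual_pt z i j) * theta_term a \<tau> X) has_sum
     (\<psi> (of_int a * dual_pt z i j) * (fa D f z a b c (of_int i / of_int dual_denom) (of_int j / of_int dual_denom) \<tau> / Omega_scale))) (coset r)"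
    unfolding ij by (rule has_sum_cmult_right[OF fa_has_sum]) (use assms r ij in auto)
  hence "((\<lambda>X. \<psi> (of_int a * X) * theta_term a \<tau> X) has_sum
     (\<psi> (of_int a * dual_pt z i j) * (fa D f z a b c (of_int i / of_int dual_denom) (of_int j / of_int dual_denom) \<tau> / Omega_scale))) (coset r)"
    by (rule has_sum_cong[THEN iffD1, rotated]) (use const ij in simp)
  thus "((\<lambda>X. \<psi> (of_int a * X) * theta_term a \<tau> X) has_sum
     (case r of (i, j) \<Rightarrow> \<psi> (of_int a * dual_pt z i j) *
        (fa D f z a b c (of_int i / of_int dual_denom) (of_int j / of_int dual_denom) \<tau> / Omega_scale))) (coset r)"
    by (simp add: ij)
qed (rule cosets_disjoint)

end
end
end

section \<open>Hecke theta functions\<close>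

context imag_quad
begin

text \<open>For a representative \<open>z\<close> let \<open>J\<close> be the integral ideal \<open>a(\<int> + \<int>z)\<close>. Every integral ideal \<open>I\<close> has a
  unique \<open>z\<close> with \<open>I q J\<close> principal, and a generator \<open>y \<in> q J\<close> is unique up to units. Hence summing over
  all pairs \<open>(z, y)\<close> counts every \<open>I\<close> exactly as often as there are units.\<close>

lemma theta_slash_in_F:
  assumes reps: "cm_reps D reps" and f: "0 < f" and h: "hecke_char D cf \<phi>"
    and q: "int_ideal D q" and dvd: "ideal_dvd D (ideal_mult q cf) (cbar D f)"
  shows "inF D f reps (slash (ideal_norm D q) (theta D \<phi>))"
proof -
  have fin: "finite reps" and CM: "\<And>z. z \<in> reps \<Longrightarrow> has_CM D z"
    and Im: "\<And>z. z \<in> reps \<Longrightarrow> Im z > 0"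
    using reps by (auto simp: cm_reps_def uhp_def)
  have "\<forall>z\<in>reps. \<exists>t. abc_of z (fst t) (fst (snd t)) (snd (snd t))"
    using ex_abc_of_CM CM Im by (metis fst_conv snd_conv)
  then obtain t where t: "\<And>z. z \<in> reps \<Longrightarrow> abc_of z (fst (t z)) (fst (snd (t z))) (snd (snd (t z)))"
    by metis
  define a where "a z = fst (t z)" for z
  define b where "b z = fst (snd (t z))" for z
  define c where "c z = snd (snd (t z))" for z
  have abc: "abc_of z (a z) (b z) (c z)" if "z \<in> reps" for z
    using t[OF that] by (simp add: a_def b_def c_def)
  have a_pos: "a z > 0" if "z \<in> reps" for z using abc[OF that] by (simp add: abc_of_def)
  define J where "J z = sc (of_int (a z)) (lattice z)" for z
  define T where "T z = ideal_mult q (J z)" for z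
  have J: "int_ideal D (J z)" and nJ: "real (ideal_norm D (J z)) = of_int (a z)" if "z \<in> reps" for z
    unfolding J_def using CM_ideal[OF abc Im CM] that by blast+
  have T: "int_ideal D (T z)" if "z \<in> reps" for z
    unfolding T_def by (rule int_ideal_mult[OF q J[OF that]])
  have TJ: "T z \<subseteq> J z" if "z \<in> reps" for z
    unfolding T_def using ideal_mult_subset_left[OF J[OF that], of q] q
    by (simp add: ideal_mult_commute int_ideal_iff)
  have nT: "real (ideal_norm D (T z)) = real (ideal_norm D q) * of_int (a z)" if "z \<in> reps" for z
    unfolding T_def ideal_norm_mult[OF q J[OF that]] using nJ[OF that] by simp
  have "\<forall>z\<in>reps. \<exists>\<psi>. (\<forall>y. y \<in> T z \<longrightarrow> y \<noteq> 0 \<longrightarrow> \<phi> (quo (T z) y) = y * \<psi> y)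
      \<and> (\<forall>y. y \<notin> T z \<longrightarrow> \<psi> y = 0)
      \<and> (\<forall>y y'. y - y' \<in> sc (of_nat f * sqrtD D) (J z) \<longrightarrow> \<psi> y = \<psi> y')"
  proof
    fix z assume z: "z \<in> reps"
    obtain \<psi> where "\<And>y. y \<in> T z \<Longrightarrow> y \<noteq> 0 \<Longrightarrow> \<phi> (quo (T z) y) = y * \<psi> y"
      "\<And>y. y \<notin> T z \<Longrightarrow> \<psi> y = 0"
      "\<And>y y'. y - y' \<in> sc (of_nat f * sqrtD D) (J z) \<Longrightarrow> \<psi> y = \<psi> y'"
      using hecke_coefficient_periodic[OF h q J[OF z] dvd] unfolding T_def by metis
    thus "\<exists>\<psi>. (\<forall>y. y \<in> T z \<longrightarrow> y \<noteq> 0 \<longrightarrow> \<phi> (quo (T z) y) = y * \<psi> y)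
      \<and> (\<forall>y. y \<notin> T z \<longrightarrow> \<psi> y = 0)
      \<and> (\<forall>y y'. y - y' \<in> sc (of_nat f * sqrtD D) (J z) \<longrightarrow> \<psi> y = \<psi> y')"
      by (intro exI[of _ \<psi>] conjI allI impI)
  qed
  then obtain \<psi> where \<psi>: "\<forall>z\<in>reps. (\<forall>y. y \<in> T z \<longrightarrow> y \<noteq> 0 \<longrightarrow> \<phi> (quo (T z) y) = y * \<psi> z y)
      \<and> (\<forall>y. y \<notin> T z \<longrightarrow> \<psi> z y = 0)
      \<and> (\<forall>y y'. y - y' \<in> sc (of_nat f * sqrtD D) (J z) \<longrightarrow> \<psi> z y = \<psi> z y')"
    by (rule bchoice[THEN exE])
  have \<psi>1: "\<phi> (quo (T z) y) = y * \<psi> z y" if "z \<in> reps" "y \<in> T z" "y \<noteq> 0" for z y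
    using \<psi> that by blast
  have \<psi>2: "\<psi> z y = 0" if "z \<in> reps" "y \<notin> T z" for z y
    using \<psi> that by blast
  have \<psi>3: "\<psi> z y = \<psi> z y'" if "z \<in> reps" "y - y' \<in> sc (of_nat f * sqrtD D) (sc (of_int (a z)) (lattice z))" for z y y'
    using \<psi> that unfolding J_def by blast
  define w where "w = card unit_set"
  have w: "w > 0" unfolding w_def using finite_unit_set one_in_unit_set by (simp add: card_gt_0_iff) blast
  define Nq where "Nq = ideal_norm D q"
  have Nq: "Nq > 0" unfolding Nq_def by (rule ideal_mult_cnj(2)[OF q])
  define gen where "gen = (\<lambda>(z, i, j). fa D f z (a z) (b z) (c z) (of_int i / of_int (dual_denom f)) (of_int j / of_int (dual_denom f)))"
  define V where "V \<tau> z = (\<Sum>(i, j)\<in>dual_reps z f. \<psi> z (of_int (a z) * dual_pt z i j) * (gen (z, i, j) \<tau> / Omega_scale (a z) f))" for \<tau> z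
  \<comment> \<open>The argument is \<open>Nq * \<tau>\<close> because \<open>quo (T z) y\<close>
    has norm \<open>|y|^2 / (Nq * a z)\<close>.\<close>
  have key: "theta D \<phi> (of_nat Nq * \<tau>) = (\<Sum>z\<in>reps. of_int (a z) * V \<tau> z) / of_nat w" if \<tau>: "Im \<tau> > 0" for \<tau>
  proof -
    define G where "G = (\<lambda>(z, y). \<phi> (quo (T z) y) * exp (2 * of_real pi * \<i> * \<tau> * of_real ((cmod y)\<^sup>2 / of_int (a z))))"
    define P where "P = Sigma reps (\<lambda>z. T z - {0})"
    have hs: "((\<lambda>y. G (z, y)) has_sum (of_int (a z) * V \<tau> z)) (T z - {0})" if z: "z \<in> reps" for z
    proof -
      define F where "F y = y * \<psi> z y * exp (2 * of_real pi * \<i> * \<tau> * of_real ((cmod y)\<^sup>2 / of_int (a z)))" for y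
      have a0: "complex_of_int (a z) \<noteq> 0" using a_pos[OF z] by simp
      have "((\<lambda>X. \<psi> z (of_int (a z) * X) * theta_term (a z) \<tau> X) has_sum V \<tau> z) (lattice z)"
        unfolding V_def gen_def prod.case
        by (rule periodic_theta_has_sum[OF abc[OF z] Im[OF z] CM[OF z] f \<psi>3[OF z] \<tau>])
      hence "((\<lambda>X. of_int (a z) * (\<psi> z (of_int (a z) * X) * theta_term (a z) \<tau> X)) has_sum (of_int (a z) * V \<tau> z)) (lattice z)"
        by (rule has_sum_cmult_right)
      moreover have "of_int (a z) * (\<psi> z (of_int (a z) * X) * theta_term (a z) \<tau> X) = F (of_int (a z) * X)" for X
      proof -
        have "(cmod (of_int (a z) * X))\<^sup>2 / of_int (a z) = of_int (a z) * (cmod X)\<^sup>2"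
          using a_pos[OF z] by (simp add: norm_mult power2_eq_square)
        thus ?thesis by (simp add: F_def theta_term_def)
      qed
      ultimately have "(F \<circ> (\<lambda>X. of_int (a z) * X) has_sum (of_int (a z) * V \<tau> z)) (lattice z)"
        by (simp add: o_def)
      hence "(F has_sum (of_int (a z) * V \<tau> z)) (J z)"
        unfolding J_def by (subst has_sum_reindex) (use a0 in \<open>auto simp: inj_on_def\<close>)
      \<comment> \<open>Passing between \<open>J z\<close> and the nonzero elements of
        \<open>T z\<close> affects only zero terms: \<open>\<psi> z\<close> vanishes off
        \<open>T z\<close>, and the factor \<open>y\<close> removes \<open>y = 0\<close>.\<close>
      thus ?thesis
      proof (rule has_sum_cong_neutral[THEN iffD1, rotated 3])
        fix y assume "y \<in> J z - (T z - {0})"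
        thus "F y = 0" using \<psi>2[OF z, of y] by (auto simp: F_def)
      next
        fix y assume "y \<in> J z \<inter> (T z - {0})"
        thus "F y = G (z, y)" using \<psi>1[OF z, of y] by (simp add: F_def G_def)
      qed (use TJ[OF z] in auto)
    qed
    have "(G has_sum (\<Sum>z\<in>reps. of_int (a z) * V \<tau> z)) (\<Union>z\<in>reps. Pair z ` (T z - {0}))"
    proof (rule sum_has_sum[OF fin])
      fix z assume "z \<in> reps"
      thus "(G has_sum (of_int (a z) * V \<tau> z)) (Pair z ` (T z - {0}))"
        using hs by (subst has_sum_reindex) (auto simp: inj_on_def o_def)
    qed auto
    also have "(\<Union>z\<in>reps. Pair z ` (T z - {0})) = P" by (auto simp: P_def)
    finally have GP: "(G has_sum (\<Sum>z\<in>reps. of_int (a z) * V \<tau> z)) P" .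
    \<comment> \<open>The pairs \<open>(z, y)\<close> are regrouped by the ideal they produce; every
      fibre has \<open>w\<close> elements, and \<open>G\<close> is constant on it.\<close>
    define fib where "fib I = {p \<in> P. quo (T (fst p)) (snd p) = I}" for I
    define S where "S = Sigma {I. int_ideal D I} fib"
    have "bij_betw snd S P"
    proof (rule bij_betw_imageI)
      show "inj_on snd S" by (auto simp: S_def fib_def inj_on_def)
      show "snd ` S = P"
      proof (intro equalityI subsetI)
        fix p assume p: "p \<in> P"
        hence "int_ideal D (quo (T (fst p)) (snd p))"
          by (intro quo_props(1)) (auto simp: P_def T)
        hence "(quo (T (fst p)) (snd p), p) \<in> S" using p by (simp add: S_def fib_def)
        thus "p \<in> snd ` S" by force
      qed (auto simp: S_def fib_def)
    qed
    from has_sum_reindex_bij_betw[OF this, of G]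
    have GS: "((\<lambda>x. G (snd x)) has_sum (\<Sum>z\<in>reps. of_int (a z) * V \<tau> z)) S" using GP by simp
    define tI where "tI I = \<phi> I * exp (2 * of_real pi * \<i> * (of_nat Nq * \<tau>) * of_nat (ideal_norm D I))" for I
    have Gfib: "G p = tI I" if pI: "p \<in> fib I" for p I
    proof -
      obtain z y where "p = (z, y)" by (cases p)
      with pI have p: "p = (z, y)" "z \<in> reps" "y \<in> T z" "y \<noteq> 0" "quo (T z) y = I"
        by (auto simp: fib_def P_def)
      have "(cmod y)\<^sup>2 / of_int (a z) = real (ideal_norm D I) * real Nq"
        using ideal_norm_quo[OF T[OF p(2)] p(3,4)] nT[OF p(2)] a_pos[OF p(2)] p(5)
        by (simp add: Nq_def field_simps)
      thus ?thesis unfolding p(1) G_def tI_def prod.case p(5) by (simp add: mult_ac)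
    qed
    have fibre: "finite (fib I) \<and> card (fib I) = w" if I: "int_ideal D I" for I
    proof -
      define Q where "Q = ideal_mult I q"
      have Q: "int_ideal D Q" unfolding Q_def by (rule int_ideal_mult[OF I q])
      have IT: "ideal_mult I (T z) = sc (of_int (a z)) (ideal_mult Q (lattice z))" for z
        unfolding T_def J_def Q_def by (simp add: ideal_mult_sc_right ideal_mult_assoc)
      have fib_iff: "(z, y) \<in> fib I \<longleftrightarrow> z \<in> reps \<and> ideal_mult I (T z) = principal D y" for z y
      proof
        assume "(z, y) \<in> fib I"
        hence zy: "z \<in> reps" "y \<in> T z" "y \<noteq> 0" "quo (T z) y = I" by (auto simp: fib_def P_def)
        thus "z \<in> reps \<and> ideal_mult I (T z) = principal D y" using quo_props(2)[OF T[OF zy(1)] zy(2,3)] by simp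
      next
        assume zy: "z \<in> reps \<and> ideal_mult I (T z) = principal D y"
        from quo_unique[OF T I, of z y] zy
        show "(z, y) \<in> fib I" by (auto simp: fib_def P_def)
      qed
      \<comment> \<open>The class of \<open>I q\<close> determines the representative
        \<open>z0\<close>; what stays free is the generator, a torsor under the units.\<close>
      obtain z0 x0 where z0: "z0 \<in> reps" "x0 \<noteq> 0" "ideal_mult Q (lattice z0) = principal D x0"
        using ex_rep_principal[OF reps Q] by metis
      define y0 where "y0 = of_int (a z0) * x0"
      have y0: "y0 \<noteq> 0" using z0(2) a_pos[OF z0(1)] by (simp add: y0_def)
      have I0: "ideal_mult I (T z0) = principal D y0" unfolding IT z0(3) principal_def sc_sc y0_def ..
      have "fib I = (\<lambda>u. (z0, u * y0)) ` unit_set"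
      proof (intro equalityI subsetI)
        fix p assume "p \<in> fib I"
        then obtain z y where p: "p = (z, y)" "z \<in> reps" "ideal_mult I (T z) = principal D y"
          using fib_iff by (metis prod.exhaust)
        have az: "complex_of_int (a z) \<noteq> 0" using a_pos[OF p(2)] by simp
        have yn: "y \<noteq> 0" by (rule quo_unique(2)[OF T[OF p(2)] I p(3)])
        have "ideal_mult Q (lattice z) = sc (1 / of_int (a z)) (principal D y)"
          using p(3) unfolding IT using sc_inverse[OF az] by metis
        also have "\<dots> = principal D (1 / of_int (a z) * y)" unfolding principal_def sc_sc ..
        finally have "z = z0"
          by (intro rep_principal_unique[OF reps Q p(2) z0(1) _ z0(2) _ z0(3)]) (use az yn in auto)
        hence "principal D y = principal D y0" using p(3) I0 by simp
        hence "y / y0 \<in> unit_set" using principal_eq_iff[OF y0] by simp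
        moreover have "p = (z0, y / y0 * y0)" using p(1) \<open>z = z0\<close> y0 by simp
        ultimately show "p \<in> (\<lambda>u. (z0, u * y0)) ` unit_set" by blast
      next
        fix p assume "p \<in> (\<lambda>u. (z0, u * y0)) ` unit_set"
        then obtain u where u: "u \<in> unit_set" "p = (z0, u * y0)" by blast
        hence "principal D (u * y0) = principal D y0" using principal_eq_iff[OF y0, of "u * y0"] y0 by simp
        thus "p \<in> fib I" unfolding u(2) fib_iff using I0 z0(1) by simp
      qed
      moreover have "inj_on (\<lambda>u. (z0, u * y0)) unit_set" using y0 by (auto simp: inj_on_def)
      ultimately show ?thesis using finite_unit_set by (simp add: card_image w_def)
    qed
    have "((\<lambda>I. of_nat w * tI I) has_sum (\<Sum>z\<in>reps. of_int (a z) * V \<tau> z)) {I. int_ideal D I}"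
    proof (rule has_sum_SigmaD[OF GS[unfolded S_def]])
      fix I assume "I \<in> {I. int_ideal D I}"
      hence fI: "finite (fib I)" "card (fib I) = w" using fibre by auto
      have "((\<lambda>p. G p) has_sum (\<Sum>p\<in>fib I. G p)) (fib I)" by (rule has_sum_finite[OF fI(1)])
      also have "(\<Sum>p\<in>fib I. G p) = (\<Sum>p\<in>fib I. tI I)" by (intro sum.cong refl Gfib)
      also have "\<dots> = of_nat w * tI I" using fI by simp
      finally show "((\<lambda>y. G (snd (I, y))) has_sum (of_nat w * tI I)) (fib I)" by simp
    qed
    hence "((\<lambda>I. of_nat w * tI I * (1 / of_nat w)) has_sum ((\<Sum>z\<in>reps. of_int (a z) * V \<tau> z) * (1 / of_nat w))) {I. int_ideal D I}"
      by (rule has_sum_cmult_left)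
    hence "(tI has_sum ((\<Sum>z\<in>reps. of_int (a z) * V \<tau> z) / of_nat w)) {I. int_ideal D I}"
      using w by simp
    thus ?thesis unfolding theta_def tI_def by (rule infsumI)
  qed
  \<comment> \<open>Collects everything independent of \<open>\<tau>\<close>: the factor
    \<open>Nq\<close> of the slash operator, the unit count, the weight and the change of
    normalisation.\<close>
  define coef where "coef = (\<lambda>(z, i, j). of_nat Nq / of_nat w * of_int (a z) * \<psi> z (of_int (a z) * dual_pt z i j) / Omega_scale (a z) f)"
  show ?thesis
  proof (rule inF_linear_combination)
    show "finite (Sigma reps (\<lambda>z. dual_reps z f))"
      using fin finite_dual_reps[OF abc Im CM f] by blast
  next
    fix p assume "p \<in> Sigma reps (\<lambda>z. dual_reps z f)"
    then obtain z i j where p: "p = (z, i, j)" "z \<in> reps" "(i, j) \<in> dual_reps z f" by auto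
    hence "dual_pt z i j \<in> lattice z" using dual_reps_def[OF abc Im CM f] by auto
    hence "in_dual f (a z) (b z) (c z) (of_int i / of_int (dual_denom f)) (of_int j / of_int (dual_denom f))"
      using in_dual_iff[OF abc Im CM f] p(2) by blast
    thus "gen p \<in> genF D f reps" unfolding p(1) gen_def prod.case genF_def using p(2) abc[OF p(2)] by blast
  next
    fix \<tau> assume "\<tau> \<in> uhp"
    hence \<tau>: "Im \<tau> > 0" by (simp add: uhp_def)
    have "slash (ideal_norm D q) (theta D \<phi>) \<tau> = of_nat Nq * ((\<Sum>z\<in>reps. of_int (a z) * V \<tau> z) / of_nat w)"
      unfolding slash_def Nq_def[symmetric] key[OF \<tau>] ..
    also have "\<dots> = (\<Sum>z\<in>reps. \<Sum>(i, j)\<in>dual_reps z f. coef (z, i, j) * gen (z, i, j) \<tau>)"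
      unfolding V_def sum_distrib_left sum_divide_distrib
      by (intro sum.cong refl) (auto simp: coef_def mult_ac)
    also have "\<dots> = (\<Sum>p\<in>Sigma reps (\<lambda>z. dual_reps z f). coef p * gen p \<tau>)"
      using fin finite_dual_reps[OF abc Im CM f] by (subst sum.Sigma) (auto simp: case_prod_unfold)
    finally show "slash (ideal_norm D q) (theta D \<phi>) \<tau> = (\<Sum>p\<in>Sigma reps (\<lambda>z. dual_reps z f). coef p * gen p \<tau>)" .
  qed
qed

end

theorem theorem3p5p1:
  fixes D :: int and f\<rho> d :: nat and reps :: "complex set"
  assumes "D < 0" and "fundamental_disc D"
    and "0 < f\<rho>" and "0 < d"
    and "cm_reps D reps"
  shows "\<forall>\<phi> cf. hecke_char D cf \<phi> \<and> ideal_dvd D cf (cbar D f\<rho>) \<longrightarrow>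
           in_union_images D f\<rho> d reps (theta D \<phi>) \<and>
           (\<forall>d'' q. 0 < d'' \<and> d'' dvd d\<^sup>2 \<and> int_ideal D q \<and>
                   ideal_dvd D (ideal_mult q cf) (cbar D f\<rho>) \<longrightarrow>
              in_union_images D f\<rho> d reps (slash (ideal_norm D q * d'') (theta D \<phi>)))"
proof (intro allI impI)
  interpret imag_quad D by unfold_locales (fact assms)+
  fix \<phi> cf assume hyp: "hecke_char D cf \<phi> \<and> ideal_dvd D cf (cbar D f\<rho>)"
  have 2: "in_union_images D f\<rho> d reps (slash (ideal_norm D q * d'') (theta D \<phi>))"
    if "0 < d''" "d'' dvd d\<^sup>2" "int_ideal D q" "ideal_dvd D (ideal_mult q cf) (cbar D f\<rho>)" for d'' q
  proof -
    have "inF D f\<rho> reps (slash (ideal_norm D q) (theta D \<phi>))"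
      using hyp by (intro theta_slash_in_F[OF assms(5,3) _ that(3,4)]) simp
    \<comment> \<open>Slash operators compose multiplicatively, so the norm of \<open>q\<close> is
      absorbed into an element of the span and only \<open>d''\<close> remains as the index of the
      image.\<close>
    moreover have "slash (ideal_norm D q * d'') (theta D \<phi>) \<tau> = slash d'' (slash (ideal_norm D q) (theta D \<phi>)) \<tau>" for \<tau>
      by (simp add: slash_def mult_ac)
    ultimately show ?thesis unfolding in_union_images_def using that(1,2) by blast
  qed
  have "int_ideal D cf" using hyp by (simp add: hecke_char_def)
  hence "ideal_mult (OK D) cf = cf" by (intro ideal_mult_OK) (simp add: int_ideal_iff)
  hence "in_union_images D f\<rho> d reps (slash (ideal_norm D (OK D) * 1) (theta D \<phi>))"
    using hyp by (intro 2 int_ideal_OK) auto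
  moreover have "slash (ideal_norm D (OK D) * 1) (theta D \<phi>) = theta D \<phi>"
    by (simp add: ideal_norm_OK slash_def fun_eq_iff)
  ultimately show "in_union_images D f\<rho> d reps (theta D \<phi>) \<and>
           (\<forall>d'' q. 0 < d'' \<and> d'' dvd d\<^sup>2 \<and> int_ideal D q \<and>
                   ideal_dvd D (ideal_mult q cf) (cbar D f\<rho>) \<longrightarrow>
              in_union_images D f\<rho> d reps (slash (ideal_norm D q * d'') (theta D \<phi>)))"
    using 2 by simp
qed

end
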